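(* For each integer $n\ge1$, \[ p(n)=p(2,3,0;n)+p(1,3,0;n) \] and \[ p_{2,4}(n)=p_{2,4}(3,4,0;n)+p_{2,4}(1,4,0;n). \]
   Context: $p(n)$ is the number of partitions of $n$; $p_{2,4}(n)$ is the number of partitions of $n$ with no part $\equiv2\pmod4$. Definition of $M(a,m,\nu;n)$ (integers $\nu\ge0$, $1\le a<m$, $n\ge0$): for a partition $\lambda_1\ge\dots\ge\lambda_k$ of $n$ into parts $\equiv a\pmod m$, put $\ell_i=(\lambda_i-a)/m+1$ (number of boxes of the row of $\lambda_i$ in the $m$-modular Young diagram), and let $t$ be the largest integer $0\le t\le k$ with $\ell_t\ge t+\nu+2$ (height of the $(\nu+2)$-Durfee rectangle, of width $t+\nu+2$). $M(a,m,\nu;n)$ counts partitions of $n$ into parts $\equiv a\pmod m$ in which each of $a,a+m,\dots,a+m\nu$ occurs at least once and $\ell_i<t+\nu+2$ for all $i>t$. Definitions: $p(a,m,\nu;n)$ is the number of partitions of $n$ such that, if $\beta$ is the sum of the parts $\not\equiv a\pmod m$, the parts $\equiv a\pmod m$ form a partition counted by $M(a,m,\nu;n-\beta)$. For $a\in\{1,3\}$, $p_{2,4}(a,4,\nu;n)$ counts partitions of $n$ into parts $\not\equiv2\pmod4$ such that, if $\alpha$ is the sum of the parts $\not\equiv a\pmod4$, the parts $\equiv a\pmod4$ form a partition counted by $M(a,4,\nu;n-\alpha)$. *)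

theory Defs
  imports "HOL-Library.Multiset" "HOL-Number_Theory.Cong"
begin

definition partitions :: "nat \<Rightarrow> nat multiset set" where
  "partitions n = {\<pi>. (\<forall>x\<in>#\<pi>. 0 < x) \<and> sum_mset \<pi> = n}"

definition p :: "nat \<Rightarrow> nat" where
  "p n = card (partitions n)"

definition partitions24 :: "nat \<Rightarrow> nat multiset set" where
  "partitions24 n = {\<pi> \<in> partitions n. \<forall>x\<in>#\<pi>. \<not> [x = 2] (mod 4)}"

definition p24 :: "nat \<Rightarrow> nat" where
  "p24 n = card (partitions24 n)"

text \<open>The \<open>i\<close>-th largest part, counted from \<open>i = 1\<close>; meaningful for \<open>1 \<le> i \<le> size \<pi>\<close>.\<close>

definition ith_part :: "nat multiset \<Rightarrow> nat \<Rightarrow> nat" where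
  "ith_part \<pi> i = rev (sorted_list_of_multiset \<pi>) ! (i - 1)"

text \<open>The number of boxes of the \<open>i\<close>-th row in the \<open>m\<close>-modular Young diagram. It is only
  used for parts \<open>x > 0\<close> congruent to \<open>a\<close> modulo \<open>m\<close> with \<open>1 \<le> a < m\<close>, so that \<open>a \<le> x\<close> and both
  the subtraction and the division are exact.\<close>

definition row_length :: "nat \<Rightarrow> nat \<Rightarrow> nat multiset \<Rightarrow> nat \<Rightarrow> nat" where
  "row_length a m \<pi> i = (ith_part \<pi> i - a) div m + 1"

text \<open>The height of the \<open>(\<nu>+2)\<close>-Durfee rectangle; height \<open>t = 0\<close> (the empty rectangle) is always
  admissible, there being no zeroth row.\<close>

definition durfee_height :: "nat \<Rightarrow> nat \<Rightarrow> nat \<Rightarrow> nat multiset \<Rightarrow> nat" where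
  "durfee_height a m \<nu> \<pi> =
     Max {t. t \<le> size \<pi> \<and> (t = 0 \<or> row_length a m \<pi> t \<ge> t + \<nu> + 2)}"

text \<open>The set of partitions counted by \<open>M(a,m,\<nu>;n)\<close>.\<close>

definition M_partitions :: "nat \<Rightarrow> nat \<Rightarrow> nat \<Rightarrow> nat \<Rightarrow> nat multiset set" where
  "M_partitions a m \<nu> n =
     {\<pi> \<in> partitions n.
        (\<forall>x\<in>#\<pi>. [x = a] (mod m)) \<and>
        (\<forall>j\<le>\<nu>. a + m * j \<in># \<pi>) \<and>
        (let t = durfee_height a m \<nu> \<pi> in
           \<forall>i. t < i \<and> i \<le> size \<pi> \<longrightarrow> row_length a m \<pi> i < t + \<nu> + 2)}"

definition p_M :: "nat \<Rightarrow> nat \<Rightarrow> nat \<Rightarrow> nat \<Rightarrow> nat" where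
  "p_M a m \<nu> n =
     card {\<pi> \<in> partitions n.
             let \<beta> = sum_mset (filter_mset (\<lambda>x. \<not> [x = a] (mod m)) \<pi>) in
               filter_mset (\<lambda>x. [x = a] (mod m)) \<pi> \<in> M_partitions a m \<nu> (n - \<beta>)}"

text \<open>\<open>p_{2,4}(a,4,\<nu>;n)\<close>, with the modulus 4 built in; intended for \<open>a \<in> {1,3}\<close>.\<close>

definition p24_M :: "nat \<Rightarrow> nat \<Rightarrow> nat \<Rightarrow> nat" where
  "p24_M a \<nu> n =
     card {\<pi> \<in> partitions24 n.
             let \<alpha> = sum_mset (filter_mset (\<lambda>x. \<not> [x = a] (mod 4)) \<pi>) in
               filter_mset (\<lambda>x. [x = a] (mod 4)) \<pi> \<in> M_partitions a 4 \<nu> (n - \<alpha>)}"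

end

theory Submission
  imports Defs "HOL-Computational_Algebra.Formal_Power_Series"
begin

text \<open>
  Let \<open>m = a + b\<close> with \<open>a \<noteq> b\<close> positive, and let \<open>P n\<close> count the partitions of \<open>n\<close> into parts
  congruent to \<open>0, a, b\<close> modulo \<open>m\<close> (\<open>m = 3\<close>: all partitions; \<open>m = 4\<close>: no part congruent to 2). Let
  \<open>P\<^sub>\<nu> n\<close> count those whose parts congruent to \<open>a\<close> are of the kind counted by \<open>M(a,m,\<nu>;\<cdot>)\<close>. A bijection
  on Durfee rectangles gives \<open>P\<^sub>\<nu> n + P\<^sub>\<nu>\<^sub>+\<^sub>1 n = P (n - e)\<close> with \<open>e = a (\<nu> + 1) + m \<nu> (\<nu> + 1) / 2\<close>,
  the right-hand side counting the partitions in which \<open>a, a + m, \<dots>, a + m \<nu>\<close> all occur. Hence \<open>P\<^sub>0\<close>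
  is an alternating sum of values of \<open>P\<close>: its generating function is that of \<open>P\<close> times minus one half
  of the Jacobi theta series without its constant term 1; the residue class \<open>b\<close> gives the other
  half. By the Jacobi triple product the full theta series times the generating function of \<open>P\<close>
  is 1, so the two counts add up to \<open>P n\<close> for \<open>n \<ge> 1\<close>. The triple product is used in its finite
  form, modulo a high power of the variable.
\<close>

section \<open>The finite Jacobi triple product\<close>

text \<open>The Gaussian binomial coefficient, defined by a q-Pascal rule instead of a quotient so
  that it makes sense for every element \<open>q\<close> of a commutative ring.\<close>

fun qbinom :: "'a::comm_ring_1 \<Rightarrow> nat \<Rightarrow> nat \<Rightarrow> 'a" where
  "qbinom q n 0 = 1"
| "qbinom q 0 (Suc k) = 0"
| "qbinom q (Suc n) (Suc k) = qbinom q n k + q ^ Suc k * qbinom q n (Suc k)"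

text \<open>The q-Pochhammer symbol (q; q)_n.\<close>

definition qpoch :: "'a::comm_ring_1 \<Rightarrow> nat \<Rightarrow> 'a" where
  "qpoch q n = (\<Prod>i<n. 1 - q ^ Suc i)"

lemma qpoch_0 [simp]: "qpoch q 0 = 1"
  by (simp add: qpoch_def)

lemma qpoch_Suc: "qpoch q (Suc n) = qpoch q n * (1 - q ^ Suc n)"
  by (simp add: qpoch_def)

lemma qbinom_eq_0: "n < k \<Longrightarrow> qbinom q n k = 0"
  by (induction q n k rule: qbinom.induct) auto

lemma qbinom_self [simp]: "qbinom q n n = 1"
  by (induction n) (auto simp: qbinom_eq_0)

text \<open>The quotient formula, cleared of denominators. The two terms of the Pascal rule
  contribute \<open>qpoch q n\<close> times \<open>1 - q ^ Suc k\<close> and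
  \<open>q ^ Suc k * (1 - q ^ Suc r)\<close>, which add up to \<open>1 - q ^ Suc n\<close>.\<close>

lemma qbinom_qpoch:
  "k \<le> n \<Longrightarrow> qbinom q n k * (qpoch q k * qpoch q (n - k)) = qpoch q n"
proof (induction q n k rule: qbinom.induct)
  case (3 q n k)
  show ?case
  proof (cases "k = n")
    case True
    then show ?thesis by (simp add: qbinom_eq_0)
  next
    case False
    with 3 have k: "k < n" by simp
    define r where "r = n - Suc k"
    have n: "n = Suc (k + r)" using k by (simp add: r_def)
    have d: "Suc n - Suc k = Suc r" "n - k = Suc r" "n - Suc k = r" by (auto simp: n)
    have A: "qbinom q n k * (qpoch q k * (qpoch q r * (1 - q ^ Suc r))) = qpoch q n"
      using 3(1) k by (simp add: d(2) qpoch_Suc)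
    have B: "qbinom q n (Suc k) * (qpoch q k * (1 - q ^ Suc k) * qpoch q r) = qpoch q n"
      using 3(2) k by (simp add: d(3) qpoch_Suc)
    have C: "q ^ Suc n = q ^ Suc k * q ^ Suc r"
      by (simp add: n power_add)
    have "qbinom q (Suc n) (Suc k) * (qpoch q (Suc k) * qpoch q (Suc n - Suc k)) =
       (1 - q ^ Suc k) * (qbinom q n k * (qpoch q k * (qpoch q r * (1 - q ^ Suc r)))) +
       q ^ Suc k * (1 - q ^ Suc r) *
         (qbinom q n (Suc k) * (qpoch q k * (1 - q ^ Suc k) * qpoch q r))"
      unfolding d(1) qbinom.simps qpoch_Suc by (simp only: algebra_simps)
    also have "\<dots> = qpoch q (Suc n)"
      unfolding A B qpoch_Suc C by (simp only: algebra_simps mult_1_left)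
    finally show ?thesis .
  qed
qed auto

text \<open>The other q-Pascal rule. To avoid division it is proved by induction: expand by the
  defining rule, apply the hypothesis to both terms, and regroup.\<close>

lemma qbinom_Suc_Suc':
  "k \<le> n \<Longrightarrow> qbinom q (Suc n) (Suc k) = q ^ (n - k) * qbinom q n k + qbinom q n (Suc k)"
proof (induction n arbitrary: k)
  case 0
  then show ?case by simp
next
  case (Suc n)
  show ?case
  proof (cases "k = Suc n")
    case True
    then show ?thesis by (simp add: qbinom_eq_0)
  next
    case False
    with Suc.prems have k: "k \<le> n" by simp
    show ?thesis
    proof (cases k)
      case 0
      then show ?thesis using Suc.IH[of 0] by (simp add: algebra_simps)
    next
      case (Suc l)
      have A: "qbinom q (Suc n) (Suc l) = q ^ (Suc n - k) * qbinom q n l + qbinom q n k"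
        using Suc.IH[of l] k by (simp add: Suc)
      have B: "qbinom q (Suc n) (Suc k) = q ^ (n - k) * qbinom q n k + qbinom q n (Suc k)"
        using Suc.IH[OF k] .
      have C: "q ^ Suc k * q ^ (n - k) = q ^ (Suc n - k) * q ^ k"
        using k by (simp flip: power_add power_Suc)
      have "qbinom q (Suc (Suc n)) (Suc k) =
         qbinom q (Suc n) (Suc l) + q ^ Suc k * qbinom q (Suc n) (Suc k)"
        by (simp add: Suc)
      also have "\<dots> = q ^ (Suc n - k) * qbinom q n l + qbinom q n k +
          (q ^ Suc k * q ^ (n - k) * qbinom q n k + q ^ Suc k * qbinom q n (Suc k))"
        unfolding A B by (simp only: algebra_simps)
      also have "\<dots> = q ^ (Suc n - k) * (qbinom q n l + q ^ Suc l * qbinom q n (Suc l)) +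
         (qbinom q n k + q ^ Suc k * qbinom q n (Suc k))"
        unfolding C by (simp only: algebra_simps Suc)
      also have "\<dots> = q ^ (Suc n - k) * qbinom q (Suc n) k + qbinom q (Suc n) (Suc k)"
        by (simp add: Suc)
      finally show ?thesis .
    qed
  qed
qed

text \<open>The defining Pascal rule summed against arbitrary coefficients; it lets \<open>L\<close>
  grow in the triple product, while \<open>sum_qbinom_Suc'\<close>, from the other rule, lets
  \<open>K\<close> grow.\<close>

lemma sum_qbinom_Suc:
  "(\<Sum>k\<le>Suc n. g k * qbinom q (Suc n) k) = (\<Sum>k\<le>n. (g (Suc k) + q ^ k * g k) * qbinom q n k)"
proof -
  have "(\<Sum>k\<le>Suc n. g k * qbinom q (Suc n) k) =
      g 0 + (\<Sum>k\<le>n. g (Suc k) * (qbinom q n k + q ^ Suc k * qbinom q n (Suc k)))"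
    by (subst sum.atMost_Suc_shift) simp
  also have "\<dots> = (\<Sum>k\<le>n. g (Suc k) * qbinom q n k) +
      (g 0 + (\<Sum>k\<le>n. g (Suc k) * q ^ Suc k * qbinom q n (Suc k)))"
    by (simp add: sum.distrib algebra_simps)
  also have "g 0 + (\<Sum>k\<le>n. g (Suc k) * q ^ Suc k * qbinom q n (Suc k)) =
      (\<Sum>k\<le>Suc n. g k * q ^ k * qbinom q n k)"
    by (subst sum.atMost_Suc_shift) simp
  also have "\<dots> = (\<Sum>k\<le>n. g k * q ^ k * qbinom q n k)"
    by (simp add: qbinom_eq_0)
  finally show ?thesis by (simp add: sum.distrib algebra_simps)
qed

lemma sum_qbinom_Suc':
  "(\<Sum>k\<le>Suc n. g k * qbinom q (Suc n) k) =
   (\<Sum>k\<le>n. (g k + q ^ (n - k) * g (Suc k)) * qbinom q n k)"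
proof -
  have "(\<Sum>k\<le>Suc n. g k * qbinom q (Suc n) k) =
      g 0 + (\<Sum>k\<le>n. g (Suc k) * (q ^ (n - k) * qbinom q n k + qbinom q n (Suc k)))"
    by (subst sum.atMost_Suc_shift)
      (auto simp: qbinom_Suc_Suc' simp del: qbinom.simps(3) intro!: sum.cong)
  also have "\<dots> = (\<Sum>k\<le>n. g (Suc k) * q ^ (n - k) * qbinom q n k) +
      (g 0 + (\<Sum>k\<le>n. g (Suc k) * qbinom q n (Suc k)))"
    by (simp add: sum.distrib algebra_simps)
  also have "g 0 + (\<Sum>k\<le>n. g (Suc k) * qbinom q n (Suc k)) = (\<Sum>k\<le>Suc n. g k * qbinom q n k)"
    by (subst sum.atMost_Suc_shift) simp
  also have "\<dots> = (\<Sum>k\<le>n. g k * qbinom q n k)"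
    by (simp add: qbinom_eq_0)
  finally show ?thesis by (simp add: sum.distrib algebra_simps)
qed

text \<open>The exponents of the theta series, \<open>a j + m j (j - 1) / 2\<close>; they are nonnegative for \<open>a \<le> m\<close>.\<close>

definition theta_exp :: "nat \<Rightarrow> nat \<Rightarrow> int \<Rightarrow> nat" where
  "theta_exp a m j = nat (int a * j + int m * (j * (j - 1) div 2))"

lemma of_nat_theta_exp:
  assumes "a \<le> m"
  shows "int (theta_exp a m j) = int a * j + int m * (j * (j - 1) div 2)"
proof -
  have "0 \<le> int a * j + int m * (j * (j - 1) div 2)"
  proof (cases "j \<ge> 1")
    case True
    then show ?thesis by (auto intro!: add_nonneg_nonneg mult_nonneg_nonneg)
  next
    case False
    \<comment> \<open>For \<open>j \<le> 0\<close> the quadratic term is at least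
      \<open>- j\<close>, and its factor \<open>m\<close> outweighs the negative term
      \<open>a * j\<close>.\<close>
    then have "j * (j - 1) \<ge> - (2 * j)"
      using mult_nonneg_nonneg[of "-j" "-j"] mult_nonneg_nonneg[of "-j" "-1-j"]
      by (cases "j = 0") (auto simp: algebra_simps)
    then have "j * (j - 1) div 2 \<ge> - j" by linarith
    then have "int m * (j * (j - 1) div 2) \<ge> int m * (- j)"
      by (intro mult_left_mono) auto
    moreover have "int a * (-j) \<le> int m * (-j)"
      using assms False by (intro mult_right_mono) auto
    ultimately show ?thesis by (simp add: algebra_simps)
  qed
  then show ?thesis by (simp add: theta_exp_def)
qed

lemma theta_exp_0 [simp]: "theta_exp a m 0 = 0"
  by (simp add: theta_exp_def)

lemma int_theta_exp_Suc:
  assumes "a \<le> m"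
  shows "int (theta_exp a m (j + 1)) = int (theta_exp a m j) + int a + int m * j"
proof -
  have "(j + 1) * (j + 1 - 1) div 2 = j * (j - 1) div 2 + j"
  proof -
    have "(j + 1) * (j + 1 - 1) = j * (j - 1) + j * 2" by (simp add: algebra_simps)
    then show ?thesis by simp
  qed
  then show ?thesis using assms by (simp add: of_nat_theta_exp algebra_simps)
qed

text \<open>Reflection swaps the two residue classes, so the negative half of the theta series for
  \<open>a\<close> is the positive half of the one for \<open>b\<close>.\<close>

lemma theta_exp_uminus:
  assumes "a + b = m"
  shows "theta_exp a m (- j) = theta_exp b m j"
proof -
  have "(- j) * (- j - 1) = j * (j - 1) + j * 2" by (simp add: algebra_simps)
  then have "(- j) * (- j - 1) div 2 = j * (j - 1) div 2 + j" by simp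
  then have "int (theta_exp a m (- j)) = int (theta_exp b m j)"
    using assms by (simp only: of_nat_theta_exp[of a m] of_nat_theta_exp[of b m])
      (auto simp: algebra_simps)
  then show ?thesis by simp
qed

text \<open>Both sides gain the same factor when \<open>K\<close> or \<open>L\<close> grows by one:
  on the right, a summed Pascal rule pairs neighbouring coefficients, and the increment of
  \<open>theta_exp\<close> turns each pair into an old coefficient times the new factor.\<close>

lemma finite_jacobi_triple:
  fixes a b m :: nat
  defines "Q \<equiv> (fps_X :: 'a :: comm_ring_1 fps) ^ m"
  assumes ab: "a + b = m"
  shows "(\<Prod>i<K. 1 - fps_X ^ (a + m * i)) * (\<Prod>i<L. 1 - fps_X ^ (b + m * i)) =
    (\<Sum>k\<le>K + L. (-1) ^ (k + L) * fps_X ^ theta_exp a m (int k - int L) * qbinom Q (K + L) k)"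
    (is "?P K L = ?S K L")
proof -
  have le: "a \<le> m" using ab by simp
  have mi: "int m = int a + int b" using ab by simp
  have S0: "?S 0 0 = 1" by simp
  have SL: "?S 0 (Suc L) = ?S 0 L * (1 - fps_X ^ (b + m * L))" for L
  proof -
    define g :: "nat \<Rightarrow> 'a fps" where
      "g k = (-1) ^ (k + Suc L) * fps_X ^ theta_exp a m (int k - int (Suc L))" for k
    \<comment> \<open>With \<open>j = k - (L + 1)\<close>, the increment \<open>a + m * j\<close> of
      the exponent equals \<open>m * k - (b + m * L)\<close>, because
      \<open>m = a + b\<close>.\<close>
    have *: "g (Suc k) + Q ^ k * g k =
       (-1) ^ (k + L) * fps_X ^ theta_exp a m (int k - int L) * (1 - fps_X ^ (b + m * L))" for k
    proof -
      define j where "j = int k - int (Suc L)"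
      have "int (theta_exp a m (j + 1)) = int (theta_exp a m j) + int a + int m * j"
        by (rule int_theta_exp_Suc[OF le])
      then have "int (theta_exp a m (j + 1) + (b + m * L)) = int (m * k + theta_exp a m j)"
        using mi by (simp add: j_def algebra_simps)
      then have e: "theta_exp a m (j + 1) + (b + m * L) = m * k + theta_exp a m j"
        by presburger
      have E: "Q ^ k * fps_X ^ theta_exp a m j =
          fps_X ^ theta_exp a m (j + 1) * fps_X ^ (b + m * L)"
        unfolding Q_def by (simp only: e flip: power_mult power_add)
      have j: "int (Suc k) - int (Suc L) = j + 1" "int k - int L = j + 1"
        by (auto simp: j_def)
      have "g (Suc k) + Q ^ k * g k = (-1) ^ (k + L) *
          (fps_X ^ theta_exp a m (j + 1) - Q ^ k * fps_X ^ theta_exp a m j)"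
        unfolding g_def j j_def[symmetric] by (simp add: algebra_simps)
      then show ?thesis unfolding E j by (simp only: right_diff_distrib mult_1_right mult.assoc)
    qed
    have "?S 0 (Suc L) = (\<Sum>k\<le>Suc L. g k * qbinom Q (Suc L) k)"
      by (simp add: g_def)
    also have "\<dots> = (\<Sum>k\<le>L. (g (Suc k) + Q ^ k * g k) * qbinom Q L k)"
      by (rule sum_qbinom_Suc)
    also have "\<dots> = ?S 0 L * (1 - fps_X ^ (b + m * L))"
      unfolding * by (simp add: sum_distrib_right sum_distrib_left mult_ac)
    finally show ?thesis .
  qed
  have SK: "?S (Suc K) L = ?S K L * (1 - fps_X ^ (a + m * K))" for K
  proof -
    define g :: "nat \<Rightarrow> 'a fps" where
      "g k = (-1) ^ (k + L) * fps_X ^ theta_exp a m (int k - int L)" for k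
    \<comment> \<open>With \<open>j = k - L\<close>, the power of \<open>Q\<close> has exponent
      \<open>m * (K - j)\<close>; adding the increment \<open>a + m * j\<close> leaves
      \<open>a + m * K\<close>, independent of \<open>k\<close>.\<close>
    have *: "g k + Q ^ (K + L - k) * g (Suc k) =
       (-1) ^ (k + L) * fps_X ^ theta_exp a m (int k - int L) * (1 - fps_X ^ (a + m * K))"
       if "k \<le> K + L" for k
    proof -
      define j where "j = int k - int L"
      define r where "r = K + L - k"
      have r: "int r = int K - j" using that by (simp add: r_def j_def)
      have "int (theta_exp a m (j + 1)) = int (theta_exp a m j) + int a + int m * j"
        by (rule int_theta_exp_Suc[OF le])
      then have "int (m * r + theta_exp a m (j + 1)) = int (theta_exp a m j + (a + m * K))"
        by (simp add: r algebra_simps)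
      then have e: "m * r + theta_exp a m (j + 1) = theta_exp a m j + (a + m * K)"
        by presburger
      have E: "Q ^ r * fps_X ^ theta_exp a m (j + 1) =
          fps_X ^ theta_exp a m j * fps_X ^ (a + m * K)"
        unfolding Q_def by (simp only: e flip: power_mult power_add)
      have j: "int (Suc k) - int L = j + 1" "int k - int L = j"
        by (auto simp: j_def)
      have "g k + Q ^ (K + L - k) * g (Suc k) = (-1) ^ (k + L) *
          (fps_X ^ theta_exp a m j - Q ^ r * fps_X ^ theta_exp a m (j + 1))"
        unfolding g_def j r_def[symmetric] by (simp add: algebra_simps)
      then show ?thesis unfolding E j by (simp only: right_diff_distrib mult_1_right mult.assoc)
    qed
    have "?S (Suc K) L = (\<Sum>k\<le>Suc (K + L). g k * qbinom Q (Suc (K + L)) k)"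
      by (simp add: g_def)
    also have "\<dots> = (\<Sum>k\<le>K + L. (g k + Q ^ (K + L - k) * g (Suc k)) * qbinom Q (K + L) k)"
      by (rule sum_qbinom_Suc')
    also have "\<dots> = (\<Sum>k\<le>K + L. ((-1) ^ (k + L) * fps_X ^ theta_exp a m (int k - int L) *
        (1 - fps_X ^ (a + m * K))) * qbinom Q (K + L) k)"
      by (intro sum.cong refl) (simp only: * atMost_iff)
    also have "\<dots> = ?S K L * (1 - fps_X ^ (a + m * K))"
      by (simp add: sum_distrib_right sum_distrib_left mult_ac)
    finally show ?thesis .
  qed
  \<comment> \<open>\<open>L\<close> grows first, at \<open>K = 0\<close>; then \<open>K\<close>
    grows with \<open>L\<close> fixed.\<close>
  have "?P 0 L = ?S 0 L" for L
    by (induction L) (simp_all only: S0 SL prod.lessThan_Suc mult.assoc[symmetric], simp)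
  then show ?thesis
  proof (induction K)
    case (Suc K)
    then have "?P K L = ?S K L" by blast
    then show ?case unfolding SK prod.lessThan_Suc by (simp only: mult_ac)
  qed blast
qed

section \<open>The triple product modulo a power of the variable\<close>

lemma qpoch_cong:
  "r \<le> n \<Longrightarrow> q ^ Suc r dvd qpoch q n - qpoch q r"
proof (induction n rule: dec_induct)
  case (step n)
  \<comment> \<open>Each factor after the first \<open>r\<close> differs from 1 by a multiple of
    \<open>q ^ Suc r\<close>.\<close>
  have "qpoch q (Suc n) - qpoch q r = (qpoch q n - qpoch q r) - qpoch q n * q ^ Suc n"
    by (simp add: qpoch_Suc algebra_simps)
  moreover have "q ^ Suc r dvd q ^ Suc n"
    using step by (intro le_imp_power_dvd) auto
  ultimately show ?case using step by (simp only: dvd_diff dvd_mult)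
qed auto

text \<open>A truncated form of the limit 1 / (q; q)_infinity of Gaussian binomials. Modulo
  \<open>Q ^ Suc r\<close> all Pochhammer symbols involved agree with \<open>D = qpoch Q r\<close>,
  so the quotient formula reads \<open>B * D * D = D\<close>; the constant term of \<open>D\<close>
  is nonzero, so one \<open>D\<close> cancels.\<close>

lemma qbinom_qpoch_cong_1:
  fixes Q :: "'a :: field fps"
  assumes Q0: "fps_nth Q 0 = 0" and "r \<le> k" "r \<le> n - k" "r \<le> K" "k \<le> n"
  shows "Q ^ Suc r dvd qbinom Q n k * qpoch Q K - 1"
proof -
  define D where "D = qpoch Q r"
  define B where "B = qbinom Q n k"
  have "fps_nth D 0 \<noteq> 0"
    unfolding D_def by (induction r) (auto simp: qpoch_Suc fps_power_zeroth Q0)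
  then have inv: "D * inverse D = 1"
    using inverse_mult_eq_1' by blast
  have c: "Q ^ Suc r dvd qpoch Q k - D" "Q ^ Suc r dvd qpoch Q (n - k) - D"
      "Q ^ Suc r dvd qpoch Q K - D" "Q ^ Suc r dvd qpoch Q n - D"
    using assms by (auto simp: D_def intro!: qpoch_cong simp del: power_Suc)
  have "B * (qpoch Q k * qpoch Q (n - k)) = qpoch Q n"
    using assms by (simp add: B_def qbinom_qpoch)
  then have "D * (B * D - 1) = (qpoch Q n - D) -
      B * (qpoch Q k * (qpoch Q (n - k) - D)) - B * D * (qpoch Q k - D)"
    by (simp add: algebra_simps)
  then have "Q ^ Suc r dvd D * (B * D - 1)"
    using c by (simp only: dvd_diff dvd_mult)
  then have "Q ^ Suc r dvd inverse D * (D * (B * D - 1))"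
    by (rule dvd_mult)
  also have "inverse D * (D * (B * D - 1)) = B * D - 1"
    using inv by (metis mult.assoc mult.commute mult_1)
  finally have "Q ^ Suc r dvd (B * D - 1) + B * (qpoch Q K - D)"
    using c(3) by (intro dvd_add dvd_mult)
  then show ?thesis by (simp add: B_def algebra_simps)
qed

text \<open>For positive \<open>j\<close> this follows from
  \<open>j * (j - 1) div 2 \<ge> j - 1\<close>, for negative \<open>j\<close> by reflection. The
  linear bound controls the error in the truncated triple product and later ends the alternating
  sum.\<close>

lemma theta_exp_ge:
  assumes "a \<le> m"
  shows "m * nat \<bar>j\<bar> \<le> theta_exp a m j + m"
proof -
  have pos: "m * nat i \<le> theta_exp c m i + m" if "c \<le> m" and i: "i \<ge> 1" for c i
  proof -
    have "(i - 1) * (i - 2) \<ge> 0"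
      using i by (cases "i = 1") auto
    then have "i * (i - 1) \<ge> 2 * (i - 1)" by (simp add: algebra_simps)
    from zdiv_mono1[OF this, of 2] have "i * (i - 1) div 2 \<ge> i - 1" by simp
    then have "int m * (i * (i - 1) div 2) \<ge> int m * (i - 1)" by (intro mult_left_mono) auto
    moreover have "int c * i \<ge> 0" using i by simp
    moreover have "int m * (i - 1) = int m * i - int m" by (simp add: algebra_simps)
    ultimately have "int m * i \<le> int (theta_exp c m i) + int m"
      unfolding of_nat_theta_exp[OF that(1)] by linarith
    then have "int (m * nat i) \<le> int (theta_exp c m i + m)" using i by simp
    then show ?thesis by presburger
  qed
  show ?thesis
    using pos[OF assms, of j] pos[of "m - a" "- j"] theta_exp_uminus[of "m - a" a m j] assms
    by (cases "j \<ge> 1"; cases "j = 0") (auto simp: abs_if)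
qed

lemma sum_symmetric_interval:
  fixes h :: "int \<Rightarrow> 'a :: comm_monoid_add"
  shows "(\<Sum>k\<le>2 * K. h (int k - int K)) =
    h 0 + ((\<Sum>i<K. h (int (Suc i))) + (\<Sum>i<K. h (- int (Suc i))))"
proof (induction K)
  case (Suc K)
  have "(\<Sum>k\<le>2 * Suc K. h (int k - int (Suc K))) =
     h (- int (Suc K)) + (\<Sum>k\<le>Suc (2 * K). h (int (Suc k) - int (Suc K)))"
    by (simp only: mult_Suc_right add_2_eq_Suc sum.atMost_Suc_shift) simp
  also have "\<dots> = h (- int (Suc K)) + ((\<Sum>k\<le>2 * K. h (int k - int K)) + h (int (Suc K)))"
    by (simp add: algebra_simps)
  finally show ?case unfolding Suc by (simp add: add_ac)
qed simp

text \<open>The finite triple product with \<open>L = K\<close>, multiplied by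
  \<open>qpoch Q K\<close>. Replacing each binomial times \<open>qpoch Q K\<close> by 1 leaves the
  theta series cut off at index \<open>K\<close>; the error in the term of index \<open>j\<close> is
  small enough because \<open>theta_exp\<close> grows with the distance of \<open>j\<close> from
  0.\<close>

lemma jacobi_triple_cong:
  fixes a b m :: nat
  assumes ab: "a + b = m" and m: "m > 0"
  shows "(fps_X :: 'a :: field fps) ^ (m * K) dvd
    (\<Prod>i<K. 1 - fps_X ^ (a + m * i)) * (\<Prod>i<K. 1 - fps_X ^ (b + m * i)) *
      (\<Prod>i<K. 1 - fps_X ^ (m * Suc i)) -
    (1 - (\<Sum>i<K. (-1) ^ i * fps_X ^ theta_exp a m (int (Suc i)))
       - (\<Sum>i<K. (-1) ^ i * fps_X ^ theta_exp b m (int (Suc i))))"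
proof -
  define Q where "Q = (fps_X :: 'a fps) ^ m"
  define h :: "int \<Rightarrow> 'a fps" where
    "h j = (if even j then 1 else -1) * fps_X ^ theta_exp a m j" for j
  have h: "(-1) ^ (k + K) * fps_X ^ theta_exp a m (int k - int K) = h (int k - int K)" for k
    by (simp add: h_def)
  have "(\<Prod>i<K. 1 - fps_X ^ (m * Suc i)) = qpoch Q K"
    unfolding qpoch_def Q_def by (simp only: power_mult)
  moreover have "(\<Prod>i<K. 1 - fps_X ^ (a + m * i)) * (\<Prod>i<K. 1 - fps_X ^ (b + m * i)) =
      (\<Sum>k\<le>2 * K. h (int k - int K) * qbinom Q (2 * K) k)"
    using finite_jacobi_triple[OF ab, of K K, where 'a = 'a]
    unfolding Q_def[symmetric] h mult_2[symmetric] .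
  moreover have "1 - (\<Sum>i<K. (-1) ^ i * fps_X ^ theta_exp a m (int (Suc i)))
       - (\<Sum>i<K. (-1) ^ i * fps_X ^ theta_exp b m (int (Suc i))) =
      (\<Sum>k\<le>2 * K. h (int k - int K))"
  proof -
    have "h (int (Suc i)) = - ((-1) ^ i * fps_X ^ theta_exp a m (int (Suc i)))" for i
      by (simp add: h_def)
    moreover have "h (- int (Suc i)) = - ((-1) ^ i * fps_X ^ theta_exp b m (int (Suc i)))" for i
      unfolding h_def theta_exp_uminus[OF ab] by simp
    moreover have "h 0 = 1" by (simp add: h_def)
    ultimately show ?thesis
      unfolding sum_symmetric_interval by (simp only: sum_negf) simp
  qed
  moreover have "fps_X ^ (m * K) dvd
      (\<Sum>k\<le>2 * K. h (int k - int K) * (qbinom Q (2 * K) k * qpoch Q K - 1))"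
  proof (rule dvd_sum)
    fix k assume "k \<in> {..2 * K}"
    then have k: "k \<le> 2 * K" by simp
    define j where "j = int k - int K"
    \<comment> \<open>This is the minimum of \<open>k\<close> and \<open>2 * K - k\<close>, hence
      the precision available for the binomial.\<close>
    define r where "r = K - nat \<bar>j\<bar>"
    have "Q ^ Suc r dvd qbinom Q (2 * K) k * qpoch Q K - 1"
      using k m by (intro qbinom_qpoch_cong_1) (auto simp: Q_def r_def j_def)
    then have "fps_X ^ theta_exp a m j * Q ^ Suc r dvd h j * (qbinom Q (2 * K) k * qpoch Q K - 1)"
      unfolding h_def by (intro mult_dvd_mono) auto
    \<comment> \<open>The exponent of the theta term makes up for the lost precision, up to one
      \<open>m\<close>, which the \<open>Suc\<close> in \<open>Suc r\<close> supplies.\<close>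
    moreover have "m * K \<le> theta_exp a m j + m * Suc r"
    proof -
      have "m * nat \<bar>j\<bar> \<le> theta_exp a m j + m"
        by (rule theta_exp_ge) (use ab in simp)
      moreover have "m * K \<le> m * (nat \<bar>j\<bar> + r)"
        by (intro mult_le_mono2) (auto simp: r_def)
      ultimately show ?thesis by (simp add: algebra_simps)
    qed
    then have "fps_X ^ (m * K) dvd fps_X ^ theta_exp a m j * Q ^ Suc r"
      unfolding Q_def power_mult[symmetric] power_add[symmetric] by (rule le_imp_power_dvd)
    ultimately show "fps_X ^ (m * K) dvd
        h (int k - int K) * (qbinom Q (2 * K) k * qpoch Q K - 1)"
      unfolding j_def by (rule dvd_trans[rotated])
  qed
  ultimately show ?thesis
    by (simp only: right_diff_distrib mult_1_right sum_subtractf sum_distrib_right mult.assoc)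
qed

section \<open>Durfee rectangles\<close>

text \<open>A partition into parts congruent to \<open>a\<close> modulo \<open>m\<close> is encoded by the multiset of the
  quotients \<open>k = (\<lambda>\<^sub>i - a) / m\<close>, so that a row of the \<open>m\<close>-modular diagram has \<open>k + 1\<close> boxes.\<close>

definition num_above :: "nat \<Rightarrow> nat multiset \<Rightarrow> nat" where
  "num_above s \<kappa> = size (filter_mset (\<lambda>k. s < k) \<kappa>)"

lemma num_above_antimono: "s \<le> s' \<Longrightarrow> num_above s' \<kappa> \<le> num_above s \<kappa>"
  by (induction \<kappa>) (auto simp: num_above_def)

lemma num_above_union [simp]: "num_above s (\<alpha> + \<beta>) = num_above s \<alpha> + num_above s \<beta>"
  by (simp add: num_above_def)

lemma num_above_all: "(\<And>k. k \<in># \<alpha> \<Longrightarrow> s < k) \<Longrightarrow> num_above s \<alpha> = size \<alpha>"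
  unfolding num_above_def by (metis filter_mset_cong filter_mset_True)

lemma num_above_none: "(\<And>k. k \<in># \<alpha> \<Longrightarrow> k \<le> s) \<Longrightarrow> num_above s \<alpha> = 0"
  unfolding num_above_def by (auto simp: not_less)

lemma num_above_le_size: "num_above s \<alpha> \<le> size \<alpha>"
  unfolding num_above_def by (rule size_filter_mset_lesseq)

lemma num_above_Suc: "num_above s \<kappa> = num_above (Suc s) \<kappa> + count \<kappa> (Suc s)"
  by (induction \<kappa>) (auto simp: num_above_def)

text \<open>A row \<open>k > t + \<nu>\<close> has at least \<open>t + \<nu> + 2\<close> boxes. So
  exactly \<open>t\<close> rows are as long as the rectangle is wide: it has height \<open>t\<close>
  and every row below it is shorter than its width.\<close>

definition exact_durfee :: "nat \<Rightarrow> nat multiset \<Rightarrow> bool" where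
  "exact_durfee \<nu> \<kappa> \<longleftrightarrow> (\<exists>t. num_above (t + \<nu>) \<kappa> = t)"

text \<open>\<open>num_above (t + \<nu>) \<kappa>\<close> is weakly decreasing in \<open>t\<close>,
  so it meets the diagonal at most once.\<close>

lemma exact_durfee_unique:
  assumes "num_above (t + \<nu>) \<kappa> = t" "num_above (t' + \<nu>) \<kappa> = t'"
  shows "t = t'"
  using assms num_above_antimono[of "t + \<nu>" "t' + \<nu>" \<kappa>] num_above_antimono[of "t' + \<nu>" "t + \<nu>" \<kappa>]
  by (cases "t \<le> t'") auto

text \<open>Only copies of the threshold \<open>w\<close> can lie on either side of the split, and
  the size of the upper half fixes how many it takes.\<close>

lemma top_part_unique:
  fixes w :: nat
  assumes eq: "\<alpha> + \<beta> = \<alpha>' + \<beta>'" and size: "size \<alpha> = size \<alpha>'"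
    and "\<And>k. k \<in># \<alpha> \<Longrightarrow> w \<le> k" "\<And>k. k \<in># \<alpha>' \<Longrightarrow> w \<le> k"
    and "\<And>k. k \<in># \<beta> \<Longrightarrow> k \<le> w" "\<And>k. k \<in># \<beta>' \<Longrightarrow> k \<le> w"
  shows "\<alpha> = \<alpha>'"
proof -
  have decomp: "\<gamma> = filter_mset (\<lambda>k. w < k) (\<gamma> + \<delta>) +
      replicate_mset (size \<gamma> - size (filter_mset (\<lambda>k. w < k) (\<gamma> + \<delta>))) w"
    if "\<And>k. k \<in># \<gamma> \<Longrightarrow> w \<le> k" "\<And>k. k \<in># \<delta> \<Longrightarrow> k \<le> w" for \<gamma> \<delta> :: "nat multiset"
  proof -
    have d: "filter_mset (\<lambda>k. w < k) \<delta> = {#}"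
      using that(2) by (auto simp: not_less)
    have "filter_mset (\<lambda>k. \<not> w < k) \<gamma> = filter_mset (\<lambda>k. k = w) \<gamma>"
      using that(1) by (intro filter_mset_cong) (force simp: not_less)+
    then have e: "filter_mset (\<lambda>k. \<not> w < k) \<gamma> = replicate_mset (count \<gamma> w) w"
      by (simp add: filter_eq_replicate_mset)
    have p: "\<gamma> = filter_mset (\<lambda>k. w < k) \<gamma> + replicate_mset (count \<gamma> w) w"
      using multiset_partition[of \<gamma> "\<lambda>k. w < k"] e by simp
    from arg_cong[OF p, of size] have "size \<gamma> = size (filter_mset (\<lambda>k. w < k) \<gamma>) + count \<gamma> w"
      by simp
    then have c: "size \<gamma> - size (filter_mset (\<lambda>k. w < k) \<gamma>) = count \<gamma> w" by simp
    show ?thesis unfolding filter_union_mset d add_0_right c by (rule p)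
  qed
  show ?thesis
    using decomp[of \<alpha> \<beta>] decomp[of \<alpha>' \<beta>'] assms by metis
qed

text \<open>Both sides of the bijection are built from a pair \<open>(\<alpha>, \<beta>)\<close> with \<open>t = size \<alpha>\<close>: appending the
  row \<open>t + \<nu> + 1\<close> spoils the Durfee condition for \<open>\<nu>\<close>, while lengthening the \<open>t\<close> rows of \<open>\<alpha>\<close> by
  one and appending the row \<open>\<nu> + 1\<close> achieves the condition for \<open>\<nu> + 1\<close>, with the same size and
  sum.\<close>

definition durfee_split :: "nat \<Rightarrow> (nat multiset \<times> nat multiset) set" where
  "durfee_split \<nu> = {(\<alpha>, \<beta>). (\<forall>k\<in>#\<alpha>. size \<alpha> + \<nu> + 1 \<le> k) \<and>
     (\<forall>k\<in>#\<beta>. k \<le> size \<alpha> + \<nu> + 1) \<and> {..\<nu>} \<subseteq> set_mset \<beta>}"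

text \<open>With \<open>t = size \<alpha>\<close>, the count \<open>num_above (s + \<nu>)\<close>
  exceeds \<open>s\<close> at \<open>s = t\<close> and is at most \<open>t\<close> at
  \<open>s = t + 1\<close>: it jumps across the diagonal. Conversely, a jump determines
  \<open>t\<close> and forces a row \<open>t + \<nu> + 1\<close>, which can be removed.\<close>

lemma bij_betw_not_exact_durfee:
  "bij_betw (\<lambda>(\<alpha>, \<beta>). \<alpha> + \<beta> + {#size \<alpha> + \<nu> + 1#}) (durfee_split \<nu>)
     {\<kappa>. {..\<nu>} \<subseteq> set_mset \<kappa> \<and> \<not> exact_durfee \<nu> \<kappa>}"
  (is "bij_betw ?f ?T ?U")
proof (rule bij_betw_imageI)
  have lower: "size \<alpha> < num_above (size \<alpha> + \<nu>) (?f (\<alpha>, \<beta>))"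
    and upper: "num_above (size \<alpha> + \<nu> + 1) (?f (\<alpha>, \<beta>)) \<le> size \<alpha>"
    if "(\<alpha>, \<beta>) \<in> ?T" for \<alpha> \<beta>
  proof -
    have "num_above (size \<alpha> + \<nu>) \<alpha> = size \<alpha>"
      using that by (intro num_above_all) (force simp: durfee_split_def)
    then show "size \<alpha> < num_above (size \<alpha> + \<nu>) (?f (\<alpha>, \<beta>))"
      by (simp add: num_above_def)
    have "num_above (size \<alpha> + \<nu> + 1) \<beta> = 0"
      using that by (intro num_above_none) (auto simp: durfee_split_def)
    then show "num_above (size \<alpha> + \<nu> + 1) (?f (\<alpha>, \<beta>)) \<le> size \<alpha>"
      using num_above_le_size[of "size \<alpha> + \<nu> + 1" \<alpha>]
        num_above_none[of "{#size \<alpha> + \<nu> + 1#}" "size \<alpha> + \<nu> + 1"]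
      by (simp only: prod.case num_above_union) simp
  qed
  have size_le: "size \<alpha>' \<le> size \<alpha>"
    if "(\<alpha>, \<beta>) \<in> ?T" "(\<alpha>', \<beta>') \<in> ?T" "?f (\<alpha>, \<beta>) = ?f (\<alpha>', \<beta>')" for \<alpha> \<beta> \<alpha>' \<beta>'
  proof (rule ccontr)
    assume "\<not> size \<alpha>' \<le> size \<alpha>"
    then have "num_above (size \<alpha>' + \<nu>) (?f (\<alpha>, \<beta>)) \<le> num_above (size \<alpha> + \<nu> + 1) (?f (\<alpha>, \<beta>))"
      by (intro num_above_antimono) auto
    with upper[OF that(1)] lower[OF that(2)] that(3) \<open>\<not> size \<alpha>' \<le> size \<alpha>\<close> show False by simp
  qed
  show "inj_on ?f ?T"
  proof (rule inj_onI)
    fix x y assume xy: "x \<in> ?T" "y \<in> ?T" "?f x = ?f y"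
    obtain \<alpha> \<beta> \<alpha>' \<beta>' where x: "x = (\<alpha>, \<beta>)" and y: "y = (\<alpha>', \<beta>')" by fastforce
    have s: "size \<alpha> = size \<alpha>'"
      using size_le[OF xy[unfolded x y]]
        size_le[OF xy(2)[unfolded y] xy(1)[unfolded x] xy(3)[unfolded x y, symmetric]]
      by (rule antisym[rotated])
    with xy have eq: "\<alpha> + \<beta> = \<alpha>' + \<beta>'" by (simp add: x y)
    have "\<alpha> = \<alpha>'"
      using xy s by (intro top_part_unique[OF eq s, of "size \<alpha> + \<nu> + 1"])
        (auto simp: durfee_split_def x y)
    with eq show "x = y" by (simp add: x y)
  qed
  show "?f ` ?T = ?U"
  proof (intro equalityI subsetI)
    fix \<kappa> assume "\<kappa> \<in> ?f ` ?T"
    then obtain \<alpha> \<beta> where T: "(\<alpha>, \<beta>) \<in> ?T" and \<kappa>: "\<kappa> = ?f (\<alpha>, \<beta>)" by force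
    have "num_above (s + \<nu>) \<kappa> \<noteq> s" for s
    proof (cases "s \<le> size \<alpha>")
      case True
      then show ?thesis
        using lower[OF T] num_above_antimono[of "s + \<nu>" "size \<alpha> + \<nu>" \<kappa>] by (simp add: \<kappa>)
    next
      case False
      then show ?thesis
        using upper[OF T] num_above_antimono[of "size \<alpha> + \<nu> + 1" "s + \<nu>" \<kappa>] by (simp add: \<kappa>)
    qed
    then show "\<kappa> \<in> ?U" using T by (auto simp: exact_durfee_def durfee_split_def \<kappa>)
  next
    fix \<kappa> assume "\<kappa> \<in> ?U"
    then have sub: "{..\<nu>} \<subseteq> set_mset \<kappa>" and ne: "\<And>t. num_above (t + \<nu>) \<kappa> \<noteq> t"
      by (auto simp: exact_durfee_def)
    \<comment> \<open>The first argument after the jump. It is positive because the inequality is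
      strict there, so its predecessor is the required \<open>t\<close>.\<close>
    define s where "s = (LEAST s. num_above (s + \<nu>) \<kappa> \<le> s)"
    have "num_above (size \<kappa> + \<nu>) \<kappa> \<le> size \<kappa>" by (rule num_above_le_size)
    then have s: "num_above (s + \<nu>) \<kappa> \<le> s" unfolding s_def by (rule LeastI)
    with ne[of s] have "num_above (s + \<nu>) \<kappa> < s" by simp
    moreover from this obtain t where t: "s = Suc t" by (cases s) auto
    ultimately have up: "num_above (t + \<nu> + 1) \<kappa> \<le> t" by simp
    have "\<not> num_above (t + \<nu>) \<kappa> \<le> t"
      using t not_less_Least[of t "\<lambda>s. num_above (s + \<nu>) \<kappa> \<le> s"] unfolding s_def by simp
    then have low: "t < num_above (t + \<nu>) \<kappa>" by simp
    define w where "w = t + \<nu> + 1"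
    define c where "c = num_above w \<kappa>"
    have c: "c \<le> t" using up by (simp add: c_def w_def)
    have cw: "t < c + count \<kappa> w"
      using low num_above_Suc[of "t + \<nu>" \<kappa>] by (simp add: c_def w_def)
    \<comment> \<open>All rows above \<open>w\<close> go to \<open>\<alpha>\<close>, filled up to
      size \<open>t\<close> with copies of \<open>w\<close>; one further copy is the removed row and
      the rest go to \<open>\<beta>\<close>. The bounds \<open>c\<close> and \<open>cw\<close> make
      the subtractions exact.\<close>
    define \<alpha> where "\<alpha> = filter_mset (\<lambda>k. w < k) \<kappa> + replicate_mset (t - c) w"
    define \<beta> where "\<beta> = filter_mset (\<lambda>k. k < w) \<kappa> + replicate_mset (count \<kappa> w - (t - c) - 1) w"
    have size: "size \<alpha> = t"
      using c by (simp add: \<alpha>_def c_def num_above_def)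
    have "\<alpha> + \<beta> + {#w#} = \<kappa>"
      by (rule multiset_eqI) (use c cw in \<open>auto simp: \<alpha>_def \<beta>_def\<close>)
    then have "\<kappa> = ?f (\<alpha>, \<beta>)" by (simp add: size w_def)
    moreover have "(\<alpha>, \<beta>) \<in> ?T"
    proof -
      have "w \<le> k" if "k \<in># \<alpha>" for k
        using that by (auto simp: \<alpha>_def split: if_splits)
      moreover have "k \<le> w" if "k \<in># \<beta>" for k
        using that by (auto simp: \<beta>_def split: if_splits)
      moreover have "{..\<nu>} \<subseteq> set_mset \<beta>"
        using sub by (auto simp: \<beta>_def w_def)
      ultimately show ?thesis
        by (auto simp: durfee_split_def size w_def)
    qed
    ultimately show "\<kappa> \<in> ?f ` ?T" by blast
  qed
qed

text \<open>After lengthening, the rows coming from \<open>\<alpha>\<close> are precisely those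
  above \<open>size \<alpha> + Suc \<nu>\<close>, so the condition holds with
  \<open>t = size \<alpha>\<close>. To invert, shorten these rows and drop one copy of
  \<open>Suc \<nu>\<close>.\<close>

lemma bij_betw_exact_durfee_Suc:
  "bij_betw (\<lambda>(\<alpha>, \<beta>). image_mset Suc \<alpha> + \<beta> + {#Suc \<nu>#}) (durfee_split \<nu>)
     {\<kappa>. {..Suc \<nu>} \<subseteq> set_mset \<kappa> \<and> exact_durfee (Suc \<nu>) \<kappa>}"
  (is "bij_betw ?g ?T ?V")
proof (rule bij_betw_imageI)
  have top: "filter_mset (\<lambda>k. size \<alpha> + Suc \<nu> < k) (?g (\<alpha>, \<beta>)) = image_mset Suc \<alpha>"
    if "(\<alpha>, \<beta>) \<in> ?T" for \<alpha> \<beta>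
  proof -
    have "filter_mset (\<lambda>k. size \<alpha> + Suc \<nu> < k) (image_mset Suc \<alpha>) = image_mset Suc \<alpha>"
      using that by (subst filter_mset_eq_conv) (auto simp: durfee_split_def)
    moreover have "filter_mset (\<lambda>k. size \<alpha> + Suc \<nu> < k) \<beta> = {#}"
      using that by (auto simp: durfee_split_def not_less)
    ultimately show ?thesis by simp
  qed
  then have num: "num_above (size \<alpha> + Suc \<nu>) (?g (\<alpha>, \<beta>)) = size \<alpha>" if "(\<alpha>, \<beta>) \<in> ?T" for \<alpha> \<beta>
    using that unfolding num_above_def by (metis size_image_mset)
  show "inj_on ?g ?T"
  proof (rule inj_onI)
    fix x y assume xy: "x \<in> ?T" "y \<in> ?T" "?g x = ?g y"
    obtain \<alpha> \<beta> \<alpha>' \<beta>' where x: "x = (\<alpha>, \<beta>)" and y: "y = (\<alpha>', \<beta>')" by fastforce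
    have s: "size \<alpha> = size \<alpha>'"
      using num xy unfolding x y by (metis exact_durfee_unique)
    have "image_mset Suc \<alpha> = image_mset Suc \<alpha>'"
      using top xy s unfolding x y by metis
    from arg_cong[OF this, of "image_mset (\<lambda>k. k - 1)"] have "\<alpha> = \<alpha>'"
      by (simp add: multiset.map_comp comp_def)
    with xy(3) show "x = y" by (simp add: x y)
  qed
  show "?g ` ?T = ?V"
  proof (intro equalityI subsetI)
    fix \<kappa> assume "\<kappa> \<in> ?g ` ?T"
    then obtain \<alpha> \<beta> where T: "(\<alpha>, \<beta>) \<in> ?T" and \<kappa>: "\<kappa> = ?g (\<alpha>, \<beta>)" by force
    have "exact_durfee (Suc \<nu>) \<kappa>" using num[OF T] unfolding exact_durfee_def \<kappa> by blast
    then show "\<kappa> \<in> ?V" using T by (auto simp: durfee_split_def \<kappa> atMost_Suc)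
  next
    fix \<kappa> assume "\<kappa> \<in> ?V"
    then obtain t where sub: "{..Suc \<nu>} \<subseteq> set_mset \<kappa>" and t: "num_above (t + Suc \<nu>) \<kappa> = t"
      by (auto simp: exact_durfee_def)
    define w where "w = t + Suc \<nu>"
    define \<alpha> where "\<alpha> = image_mset (\<lambda>k. k - 1) (filter_mset (\<lambda>k. w < k) \<kappa>)"
    define \<beta> where "\<beta> = filter_mset (\<lambda>k. \<not> w < k) \<kappa> - {#Suc \<nu>#}"
    have size: "size \<alpha> = t" using t by (simp add: \<alpha>_def num_above_def w_def)
    have "image_mset Suc \<alpha> = image_mset (\<lambda>k. k) (filter_mset (\<lambda>k. w < k) \<kappa>)"
      unfolding \<alpha>_def multiset.map_comp by (intro image_mset_cong) auto
    moreover have "\<beta> + {#Suc \<nu>#} = filter_mset (\<lambda>k. \<not> w < k) \<kappa>"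
      using sub by (auto simp: \<beta>_def w_def)
    ultimately have "?g (\<alpha>, \<beta>) = \<kappa>"
      by (simp only: prod.case add.assoc multiset.map_ident flip: multiset_partition)
    moreover have "(\<alpha>, \<beta>) \<in> ?T"
    proof -
      have "j \<in># \<beta>" if "j \<le> \<nu>" for j
      proof -
        have "count \<beta> j = count \<kappa> j" using that by (simp add: \<beta>_def w_def)
        moreover have "j \<in># \<kappa>" using that sub by auto
        ultimately show ?thesis by (metis count_eq_zero_iff)
      qed
      moreover have "k \<le> w" if "k \<in># \<beta>" for k
        using in_diffD[OF that[unfolded \<beta>_def]] by (auto simp: not_less)
      moreover have "w \<le> k" if "k \<in># \<alpha>" for k
        using that by (auto simp: \<alpha>_def)
      ultimately show ?thesis
        by (auto simp: durfee_split_def size w_def)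
    qed
    ultimately show "\<kappa> \<in> ?g ` ?T" by (rule image_eqI[OF sym])
  qed
qed

text \<open>Size and sum must both be preserved, because the parts \<open>a + m * k\<close> add up
  to \<open>a\<close> times the size plus \<open>m\<close> times the sum.\<close>

lemma exact_durfee_bijection:
  obtains h where
    "bij_betw h {\<kappa>. {..\<nu>} \<subseteq> set_mset \<kappa> \<and> \<not> exact_durfee \<nu> \<kappa>}
       {\<kappa>. {..Suc \<nu>} \<subseteq> set_mset \<kappa> \<and> exact_durfee (Suc \<nu>) \<kappa>}"
    "\<And>\<kappa>. {..\<nu>} \<subseteq> set_mset \<kappa> \<Longrightarrow> \<not> exact_durfee \<nu> \<kappa> \<Longrightarrow>
       size (h \<kappa>) = size \<kappa> \<and> sum_mset (h \<kappa>) = sum_mset \<kappa>"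
proof -
  define f where "f = (\<lambda>(\<alpha>, \<beta>). \<alpha> + \<beta> + {#size \<alpha> + \<nu> + 1#})"
  define g where "g = (\<lambda>(\<alpha>, \<beta>). image_mset Suc \<alpha> + \<beta> + {#Suc \<nu>#})"
  define T where "T = durfee_split \<nu>"
  note f = bij_betw_not_exact_durfee[of \<nu>, folded f_def T_def]
  note g = bij_betw_exact_durfee_Suc[of \<nu>, folded g_def T_def]
  have sum_Suc: "sum_mset (image_mset Suc \<alpha>) = sum_mset \<alpha> + size \<alpha>" for \<alpha>
    by (induction \<alpha>) auto
  have same: "size (g x) = size (f x) \<and> sum_mset (g x) = sum_mset (f x)" for x
    by (cases x) (auto simp: f_def g_def sum_Suc)
  show ?thesis
  proof (rule that[of "g \<circ> inv_into T f"])
    show "bij_betw (g \<circ> inv_into T f) {\<kappa>. {..\<nu>} \<subseteq> set_mset \<kappa> \<and> \<not> exact_durfee \<nu> \<kappa>}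
       {\<kappa>. {..Suc \<nu>} \<subseteq> set_mset \<kappa> \<and> exact_durfee (Suc \<nu>) \<kappa>}"
      by (rule bij_betw_trans[OF bij_betw_inv_into[OF f] g])
  next
    fix \<kappa> assume "{..\<nu>} \<subseteq> set_mset \<kappa>" "\<not> exact_durfee \<nu> \<kappa>"
    then have "f (inv_into T f \<kappa>) = \<kappa>"
      using bij_betw_inv_into_right[OF f] by blast
    then show "size ((g \<circ> inv_into T f) \<kappa>) = size \<kappa> \<and> sum_mset ((g \<circ> inv_into T f) \<kappa>) = sum_mset \<kappa>"
      using same[of "inv_into T f \<kappa>"] by simp
  qed
qed

section \<open>From row multisets back to parts and modular diagrams\<close>

definition scale_mset :: "nat \<Rightarrow> nat \<Rightarrow> nat multiset \<Rightarrow> nat multiset" where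
  "scale_mset a m \<kappa> = image_mset (\<lambda>k. a + m * k) \<kappa>"

lemma size_scale_mset [simp]: "size (scale_mset a m \<kappa>) = size \<kappa>"
  by (simp add: scale_mset_def)

lemma sum_scale_mset: "sum_mset (scale_mset a m \<kappa>) = a * size \<kappa> + m * sum_mset \<kappa>"
  by (induction \<kappa>) (auto simp: scale_mset_def algebra_simps)

lemma nth_greater_iff:
  fixes xs :: "nat list"
  assumes "sorted_wrt (\<ge>) xs" "i < length xs"
  shows "s < xs ! i \<longleftrightarrow> i < length (filter (\<lambda>k. s < k) xs)"
  using assms
proof (induction xs arbitrary: i)
  case (Cons x xs)
  show ?case
  proof (cases "s < x")
    case True
    then show ?thesis using Cons by (cases i) auto
  next
    case False
    then have "\<forall>k\<in>set (x # xs). \<not> s < k" using Cons.prems by force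
    then show ?thesis using Cons.prems nth_mem[of i "x # xs"] by (auto simp: filter_empty_conv)
  qed
qed simp

text \<open>The rows with at least \<open>s + 2\<close> boxes are those with \<open>k > s\<close>,
  and they come first in decreasing order.\<close>

lemma row_length_scale_mset:
  assumes m: "m > 0" and t: "1 \<le> t" "t \<le> size \<kappa>"
  shows "row_length a m (scale_mset a m \<kappa>) t \<ge> s + 2 \<longleftrightarrow> t \<le> num_above s \<kappa>"
proof -
  define ys where "ys = sorted_list_of_multiset \<kappa>"
  have ys: "mset ys = \<kappa>" "sorted ys" by (auto simp: ys_def)
  have len: "length ys = size \<kappa>" using ys(1) by (metis size_mset)
  have "sorted (map (\<lambda>k. a + m * k) ys)"
    using ys(2) by (auto simp: sorted_map intro: sorted_wrt_mono_rel[rotated])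
  then have "sorted_list_of_multiset (scale_mset a m \<kappa>) = map (\<lambda>k. a + m * k) ys"
    unfolding scale_mset_def ys(1)[symmetric] mset_map[symmetric] sorted_list_of_multiset_mset
    by (rule sorted_sort_id)
  then have "row_length a m (scale_mset a m \<kappa>) t = rev ys ! (t - 1) + 1"
    using t len m by (simp add: row_length_def ith_part_def rev_map)
  moreover have "s < rev ys ! (t - 1) \<longleftrightarrow> t - 1 < length (filter (\<lambda>k. s < k) (rev ys))"
    using ys(2) t len by (intro nth_greater_iff) (auto simp: sorted_wrt_rev)
  moreover have "length (filter (\<lambda>k. s < k) (rev ys)) = num_above s \<kappa>"
    unfolding num_above_def ys(1)[symmetric] by (simp flip: mset_filter rev_filter)
  ultimately show ?thesis using t by auto
qed

text \<open>The Durfee height is the largest \<open>t\<close> with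
  \<open>t \<le> num_above (t + \<nu>) \<kappa>\<close>, and the condition on the lower rows is the
  reverse inequality. Conversely, any solution of the equality must be this maximum, by
  monotonicity.\<close>

lemma durfee_condition_iff_exact_durfee:
  assumes m: "m > 0"
  shows "(let t = durfee_height a m \<nu> (scale_mset a m \<kappa>) in
      \<forall>i. t < i \<and> i \<le> size (scale_mset a m \<kappa>) \<longrightarrow>
        row_length a m (scale_mset a m \<kappa>) i < t + \<nu> + 2) \<longleftrightarrow> exact_durfee \<nu> \<kappa>"
proof -
  define A where "A = {t. t \<le> num_above (t + \<nu>) \<kappa>}"
  have eq: "{t. t \<le> size \<kappa> \<and> (t = 0 \<or> row_length a m (scale_mset a m \<kappa>) t \<ge> t + \<nu> + 2)} = A"
    (is "?B = A")
  proof (intro equalityI subsetI)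
    fix t assume "t \<in> ?B"
    then show "t \<in> A"
      using row_length_scale_mset[OF m, of t \<kappa> "t + \<nu>" a] by (cases "t = 0") (auto simp: A_def)
  next
    fix t assume "t \<in> A"
    moreover from this have "t \<le> size \<kappa>"
      using num_above_le_size[of "t + \<nu>" \<kappa>] by (auto simp: A_def)
    ultimately show "t \<in> ?B"
      using row_length_scale_mset[OF m, of t \<kappa> "t + \<nu>" a] by (cases "t = 0") (auto simp: A_def)
  qed
  define t where "t = durfee_height a m \<nu> (scale_mset a m \<kappa>)"
  have t: "t = Max A" by (simp add: t_def durfee_height_def eq del: add_2_eq_Suc')
  have fin: "finite A"
    by (rule finite_subset[of _ "{..size \<kappa>}"])
      (auto simp: A_def intro: order_trans[OF _ num_above_le_size])
  \<comment> \<open>The empty rectangle makes the maximum well defined.\<close>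
  have "0 \<in> A" by (simp add: A_def)
  with fin t have tA: "t \<in> A" by (metis Max_in empty_iff)
  have "(\<forall>i. t < i \<and> i \<le> size \<kappa> \<longrightarrow> row_length a m (scale_mset a m \<kappa>) i < t + \<nu> + 2) \<longleftrightarrow>
      (\<forall>i. t < i \<and> i \<le> size \<kappa> \<longrightarrow> \<not> i \<le> num_above (t + \<nu>) \<kappa>)"
    using row_length_scale_mset[OF m, of _ \<kappa> "t + \<nu>" a]
    by (metis One_nat_def Suc_leI le_0_eq not_less not_less0 zero_less_iff_neq_zero)
  also have "\<dots> \<longleftrightarrow> num_above (t + \<nu>) \<kappa> \<le> t"
    using num_above_le_size[of "t + \<nu>" \<kappa>] by (meson leI le_trans not_le order_refl)
  also have "\<dots> \<longleftrightarrow> num_above (t + \<nu>) \<kappa> = t"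
    using tA by (auto simp: A_def)
  also have "\<dots> \<longleftrightarrow> exact_durfee \<nu> \<kappa>"
  proof
    assume "exact_durfee \<nu> \<kappa>"
    then obtain s where s: "num_above (s + \<nu>) \<kappa> = s" by (auto simp: exact_durfee_def)
    then have "s \<in> A" by (simp add: A_def)
    then have "s \<le> t" using fin t by simp
    then have "num_above (t + \<nu>) \<kappa> \<le> s"
      using num_above_antimono[of "s + \<nu>" "t + \<nu>" \<kappa>] s by simp
    with tA \<open>s \<le> t\<close> s show "num_above (t + \<nu>) \<kappa> = t" by (auto simp: A_def)
  qed (auto simp: exact_durfee_def)
  finally show ?thesis unfolding Let_def size_scale_mset t_def .
qed

section \<open>Partitions with parts in a given set\<close>

definition parts_in :: "nat set \<Rightarrow> nat \<Rightarrow> nat multiset set" where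
  "parts_in S n = {\<pi> \<in> partitions n. set_mset \<pi> \<subseteq> S}"

lemma finite_partitions: "finite (partitions n)"
proof (rule finite_subset)
  show "partitions n \<subseteq> mset ` {xs. set xs \<subseteq> {..n} \<and> length xs \<le> n}"
  proof
    fix \<pi> assume "\<pi> \<in> partitions n"
    then have pos: "\<forall>x\<in>#\<pi>. 0 < x" and sum: "sum_mset \<pi> = n" by (auto simp: partitions_def)
    obtain xs where xs: "\<pi> = mset xs" by (metis ex_mset)
    have "\<forall>x\<in>set xs. x \<le> n"
      using sum member_le_sum_list[of _ xs] by (auto simp: xs sum_mset_sum_list)
    moreover have "length xs \<le> n"
      using pos sum unfolding xs by (induction xs arbitrary: n) force+
    ultimately show "\<pi> \<in> mset ` {xs. set xs \<subseteq> {..n} \<and> length xs \<le> n}" using xs by auto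
  qed
  show "finite (mset ` {xs. set xs \<subseteq> {..n} \<and> length xs \<le> n})"
    by (intro finite_imageI finite_lists_length_le) simp
qed

lemma finite_parts_in: "finite (parts_in S n)"
  using finite_partitions by (simp add: parts_in_def)

text \<open>Removing \<open>D\<close> is a bijection. It is applied to a single part, for generating
  functions, and to the forced parts \<open>a, a + m, ..., a + m * \<nu>\<close>.\<close>

lemma card_parts_in_supermset:
  assumes "set_mset D \<subseteq> S" "0 \<notin># D"
  shows "card {\<pi> \<in> parts_in S n. D \<subseteq># \<pi>} =
    (if sum_mset D \<le> n then card (parts_in S (n - sum_mset D)) else 0)"
proof (cases "sum_mset D \<le> n")
  case True
  have "bij_betw (\<lambda>\<pi>. \<pi> + D) (parts_in S (n - sum_mset D)) {\<pi> \<in> parts_in S n. D \<subseteq># \<pi>}"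
  proof (rule bij_betw_byWitness[where f' = "\<lambda>\<pi>. \<pi> - D"])
    show "(\<lambda>\<pi>. \<pi> + D) ` parts_in S (n - sum_mset D) \<subseteq> {\<pi> \<in> parts_in S n. D \<subseteq># \<pi>}"
      using assms True by (auto simp: parts_in_def partitions_def) (metis gr0I)
    show "(\<lambda>\<pi>. \<pi> - D) ` {\<pi> \<in> parts_in S n. D \<subseteq># \<pi>} \<subseteq> parts_in S (n - sum_mset D)"
      by (auto simp: parts_in_def partitions_def sum_mset_diff dest: in_diffD)
  qed auto
  then show ?thesis using True by (simp add: bij_betw_same_card)
next
  case False
  have "{\<pi> \<in> parts_in S n. D \<subseteq># \<pi>} = {}"
    using False
    by (auto simp: parts_in_def partitions_def dest!: mset_subset_eq_exists_conv[THEN iffD1])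
  then show ?thesis using False by (simp only: card.empty if_False)
qed

text \<open>Rational coefficients are taken because the congruence for the triple product is stated
  over a field.\<close>

definition parts_gf :: "nat set \<Rightarrow> rat fps" where
  "parts_gf S = Abs_fps (\<lambda>n. of_nat (card (parts_in S n)))"

lemma parts_gf_remove:
  assumes "s \<in> S" "s > 0"
  shows "parts_gf S * (1 - fps_X ^ s) = parts_gf (S - {s})"
proof (rule fps_ext)
  fix n
  have "parts_in S n = parts_in (S - {s}) n \<union> {\<pi> \<in> parts_in S n. {#s#} \<subseteq># \<pi>}"
    by (auto simp: parts_in_def)
  moreover have "parts_in (S - {s}) n \<inter> {\<pi> \<in> parts_in S n. {#s#} \<subseteq># \<pi>} = {}"
    by (auto simp: parts_in_def)
  ultimately have "card (parts_in S n) =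
      card (parts_in (S - {s}) n) + card {\<pi> \<in> parts_in S n. {#s#} \<subseteq># \<pi>}"
    by (metis (no_types, lifting) card_Un_disjoint finite_parts_in finite_Un)
  also have "card {\<pi> \<in> parts_in S n. {#s#} \<subseteq># \<pi>} = (if s \<le> n then card (parts_in S (n - s)) else 0)"
    using card_parts_in_supermset[of "{#s#}" S n] assms by simp
  finally show "fps_nth (parts_gf S * (1 - fps_X ^ s)) n = fps_nth (parts_gf (S - {s})) n"
    by (simp add: parts_gf_def right_diff_distrib fps_X_power_mult_right_nth)
qed

lemma parts_gf_prod:
  assumes "finite F" "F \<subseteq> S" "0 \<notin> F"
  shows "parts_gf S * (\<Prod>s\<in>F. 1 - fps_X ^ s) = parts_gf (S - F)"
  using assms
proof (induction F rule: finite_induct)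
  case (insert s F)
  have "parts_gf S * (\<Prod>s\<in>insert s F. 1 - fps_X ^ s) = parts_gf (S - F) * (1 - fps_X ^ s)"
    using insert by (simp add: mult_ac flip: insert.IH)
  also have "\<dots> = parts_gf (S - F - {s})"
    using insert by (intro parts_gf_remove) auto
  also have "S - F - {s} = S - insert s F" by auto
  finally show ?case .
qed simp

text \<open>A partition of \<open>n > 0\<close> has a part between 1 and \<open>n\<close>. The value
  0 is allowed in \<open>S\<close> because the sets used below contain it, though it is never a
  part.\<close>

lemma parts_gf_nth_eq_0:
  assumes "\<And>s. s \<in> S \<Longrightarrow> s = 0 \<or> n < s" "n > 0"
  shows "fps_nth (parts_gf S) n = 0"
proof -
  have "parts_in S n = {}"
  proof (rule ccontr)
    assume "parts_in S n \<noteq> {}"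
    then obtain \<pi> where "\<forall>x\<in>#\<pi>. 0 < x" "sum_mset \<pi> = n" "set_mset \<pi> \<subseteq> S"
      unfolding parts_in_def partitions_def by blast
    moreover from this assms(2) obtain x \<rho> where "\<pi> = add_mset x \<rho>"
      by (cases \<pi>) auto
    ultimately show False using assms(1)[of x] by auto
  qed
  then show ?thesis by (simp add: parts_gf_def)
qed

text \<open>Multiplying by the finite product \<open>T\<close> forbids the first \<open>K\<close>
  positive parts of each class; those left are at least \<open>m * K > n\<close>, so the coefficient
  vanishes. The theta polynomial agrees with \<open>T\<close> modulo \<open>fps_X ^ (m * K)\<close>.
  As \<open>a\<close> and \<open>b\<close> differ, no factor is repeated.\<close>

lemma parts_gf_theta:
  assumes ab: "a + b = m" "0 < a" "0 < b" "a \<noteq> b" and n: "0 < n" "n < m * K"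
  defines "S \<equiv> {x. x mod m \<in> {0, a, b}}"
  shows "fps_nth (parts_gf S * (1 - (\<Sum>i<K. (-1) ^ i * fps_X ^ theta_exp a m (int (Suc i)))
       - (\<Sum>i<K. (-1) ^ i * fps_X ^ theta_exp b m (int (Suc i))))) n = 0"
proof -
  define \<Theta> :: "rat fps" where
    "\<Theta> = 1 - (\<Sum>i<K. (-1) ^ i * fps_X ^ theta_exp a m (int (Suc i)))
       - (\<Sum>i<K. (-1) ^ i * fps_X ^ theta_exp b m (int (Suc i)))"
  define T :: "rat fps" where
    "T = (\<Prod>i<K. 1 - fps_X ^ (a + m * i)) * (\<Prod>i<K. 1 - fps_X ^ (b + m * i)) *
      (\<Prod>i<K. 1 - fps_X ^ (m * Suc i))"
  have lt: "a < m" "b < m" "m > 0" using ab by auto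
  define A where "A = (\<lambda>i. a + m * i) ` {..<K}"
  define B where "B = (\<lambda>i. b + m * i) ` {..<K}"
  define C where "C = (\<lambda>i. m * Suc i) ` {..<K}"
  have mods: "x \<in> A \<Longrightarrow> x mod m = a" "x \<in> B \<Longrightarrow> x mod m = b" "x \<in> C \<Longrightarrow> x mod m = 0" for x
    using lt by (auto simp: A_def B_def C_def)
  have inj: "inj_on (\<lambda>i. c + m * i) {..<K}" "inj_on (\<lambda>i. m * Suc i) {..<K}" for c
    using lt by (auto simp: inj_on_def)
  have "T = (\<Prod>s\<in>A \<union> B \<union> C. 1 - fps_X ^ s)"
  proof -
    have "(A \<union> B) \<inter> C = {}" "A \<inter> B = {}"
      using mods ab by fastforce+
    moreover have "finite A" "finite B" "finite C" by (auto simp: A_def B_def C_def)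
    ultimately have "(\<Prod>s\<in>A \<union> B \<union> C. 1 - fps_X ^ s :: rat fps) =
        (\<Prod>s\<in>A. 1 - fps_X ^ s) * (\<Prod>s\<in>B. 1 - fps_X ^ s) * (\<Prod>s\<in>C. 1 - fps_X ^ s)"
      by (simp only: prod.union_disjoint finite_UnI)
    then show ?thesis
      unfolding T_def A_def B_def C_def prod.reindex[OF inj(1)] prod.reindex[OF inj(2)] comp_def ..
  qed
  moreover have "parts_gf S * (\<Prod>s\<in>A \<union> B \<union> C. 1 - fps_X ^ s) = parts_gf (S - (A \<union> B \<union> C))"
  proof (rule parts_gf_prod)
    show "A \<union> B \<union> C \<subseteq> S" using mods by (auto simp: S_def)
    show "0 \<notin> A \<union> B \<union> C" using ab lt by (auto simp: A_def B_def C_def)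
  qed (auto simp: A_def B_def C_def)
  moreover have "fps_nth (parts_gf (S - (A \<union> B \<union> C))) n = 0"
  proof (rule parts_gf_nth_eq_0)
    fix x assume x: "x \<in> S - (A \<union> B \<union> C)"
    define i where "i = x div m"
    have eq: "x = x mod m + m * i" by (simp add: i_def)
    have "i \<ge> K" if "x mod m = a \<or> x mod m = b"
    proof (rule ccontr)
      assume "\<not> i \<ge> K"
      with eq that have "x \<in> A \<or> x \<in> B"
        unfolding A_def B_def by (metis image_eqI lessThan_iff not_le)
      with x show False by blast
    qed
    \<comment> \<open>The multiples of \<open>m\<close> in \<open>C\<close> start at
      \<open>m\<close> itself, so 0 also survives.\<close>
    moreover have "i = 0 \<or> i \<ge> K" if "x mod m = 0"
    proof (rule ccontr)
      assume "\<not> (i = 0 \<or> i \<ge> K)"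
      with eq that have "x = m * Suc (i - 1)" "i - 1 < K" by auto
      then have "x \<in> C" unfolding C_def by blast
      with x show False by blast
    qed
    ultimately have "x = 0 \<or> i \<ge> K" using x eq by (auto simp: S_def)
    moreover have "n < x" if "i \<ge> K"
    proof -
      have "m * K \<le> m * i" using that by (rule mult_le_mono2)
      with n(2) eq show ?thesis by linarith
    qed
    ultimately show "x = 0 \<or> n < x" by blast
  qed (rule n)
  ultimately have "fps_nth (parts_gf S * T) n = 0" by simp
  moreover obtain h where "T - \<Theta> = fps_X ^ (m * K) * h"
    using jacobi_triple_cong[OF ab(1) lt(3), of K] unfolding T_def \<Theta>_def by (rule dvdE)
  then have "parts_gf S * \<Theta> = parts_gf S * T - fps_X ^ (m * K) * (h * parts_gf S)"
    by (simp add: algebra_simps)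
  ultimately have "fps_nth (parts_gf S * \<Theta>) n = 0"
    using n by (simp add: fps_X_power_mult_nth)
  then show ?thesis by (simp only: \<Theta>_def)
qed

section \<open>The parts in one residue class\<close>

definition residue_rows :: "nat \<Rightarrow> nat \<Rightarrow> nat multiset \<Rightarrow> nat multiset" where
  "residue_rows a m \<pi> = image_mset (\<lambda>x. x div m) (filter_mset (\<lambda>x. [x = a] (mod m)) \<pi>)"

lemma cong_residue_eq:
  assumes "a < m" "[x = a] (mod m)"
  shows "a + m * (x div m) = (x :: nat)"
  using assms mod_mult_div_eq[of x m] by (simp add: cong_def)

lemma scale_residue_rows:
  assumes "a < m"
  shows "scale_mset a m (residue_rows a m \<pi>) = filter_mset (\<lambda>x. [x = a] (mod m)) \<pi>"
proof -
  have "scale_mset a m (residue_rows a m \<pi>) =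
      image_mset (\<lambda>x. x) (filter_mset (\<lambda>x. [x = a] (mod m)) \<pi>)"
    unfolding scale_mset_def residue_rows_def multiset.map_comp
    using cong_residue_eq[OF assms] by (intro image_mset_cong) auto
  then show ?thesis by simp
qed

lemma residue_rows_scale:
  assumes "a < m" "\<And>x. x \<in># \<sigma> \<Longrightarrow> \<not> [x = a] (mod m)"
  shows "residue_rows a m (scale_mset a m \<kappa> + \<sigma>) = \<kappa>"
    and "filter_mset (\<lambda>x. \<not> [x = a] (mod m)) (scale_mset a m \<kappa> + \<sigma>) = \<sigma>"
proof -
  have c: "[a + m * k = a] (mod m)" "(a + m * k) div m = k" for k
    using assms(1) by (auto simp: cong_def)
  have "filter_mset (\<lambda>x. [x = a] (mod m)) \<sigma> = {#}" "filter_mset (\<lambda>x. \<not> [x = a] (mod m)) \<sigma> = \<sigma>"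
    using assms(2) by (auto simp: filter_mset_eq_conv)
  moreover have "filter_mset (\<lambda>x. [x = a] (mod m)) (scale_mset a m \<kappa>) = scale_mset a m \<kappa>"
    "filter_mset (\<lambda>x. \<not> [x = a] (mod m)) (scale_mset a m \<kappa>) = {#}"
    by (auto simp: filter_mset_eq_conv scale_mset_def c(1))
  ultimately show "residue_rows a m (scale_mset a m \<kappa> + \<sigma>) = \<kappa>"
    and "filter_mset (\<lambda>x. \<not> [x = a] (mod m)) (scale_mset a m \<kappa> + \<sigma>) = \<sigma>"
    by (simp_all only: residue_rows_def filter_union_mset)
      (simp_all add: scale_mset_def multiset.map_comp comp_def c(2) assms(1))
qed

lemma residue_rows_decompose:
  assumes "a < m"
  shows "scale_mset a m (residue_rows a m \<pi>) + filter_mset (\<lambda>x. \<not> [x = a] (mod m)) \<pi> = \<pi>"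
  unfolding scale_residue_rows[OF assms] by (rule multiset_partition[symmetric])

lemma subset_residue_rows_iff:
  assumes "a < m"
  shows "{..\<nu>} \<subseteq> set_mset (residue_rows a m \<pi>) \<longleftrightarrow> (\<forall>j\<le>\<nu>. a + m * j \<in># \<pi>)"
proof -
  have c: "[a + m * k = a] (mod m)" "(a + m * k) div m = k" for k
    using assms(1) by (auto simp: cong_def)
  have "j \<in># residue_rows a m \<pi> \<longleftrightarrow> a + m * j \<in># \<pi>" for j
    unfolding residue_rows_def using c cong_residue_eq[OF assms] by force
  then show ?thesis by auto
qed

text \<open>The bijection acts on the rows of the class of \<open>a\<close> and leaves all other
  parts alone. The hypothesis on \<open>S\<close> makes every new part admissible.\<close>

lemma card_parts_in_transfer:
  assumes a: "0 < a" "a < m" and S: "{x. [x = a] (mod m)} \<subseteq> S"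
    and h: "bij_betw h U V"
    and same: "\<And>\<kappa>. \<kappa> \<in> U \<Longrightarrow> size (h \<kappa>) = size \<kappa> \<and> sum_mset (h \<kappa>) = sum_mset \<kappa>"
  shows "card {\<pi> \<in> parts_in S n. residue_rows a m \<pi> \<in> U} =
    card {\<pi> \<in> parts_in S n. residue_rows a m \<pi> \<in> V}"
proof -
  let ?rest = "filter_mset (\<lambda>x. \<not> [x = a] (mod m))"
  define g where "g = inv_into U h"
  \<comment> \<open>The row map is an argument of \<open>H\<close>, so that the same construction
    gives the inverse from \<open>g\<close>.\<close>
  define H where "H h \<pi> = scale_mset a m (h (residue_rows a m \<pi>)) + ?rest \<pi>" for h \<pi>
  have rows: "residue_rows a m (H h \<pi>) = h (residue_rows a m \<pi>)" "?rest (H h \<pi>) = ?rest \<pi>" for h \<pi>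
    unfolding H_def by (intro residue_rows_scale a(2); simp)+
  have gh: "g (h \<kappa>) = \<kappa>" if "\<kappa> \<in> U" for \<kappa>
    unfolding g_def using bij_betw_inv_into_left[OF h that] .
  have hg: "h (g \<kappa>) = \<kappa>" and gU: "g \<kappa> \<in> U" if "\<kappa> \<in> V" for \<kappa>
    unfolding g_def using bij_betw_inv_into_right[OF h that]
      bij_betw_apply[OF bij_betw_inv_into[OF h] that] by auto
  have mem: "H k \<pi> \<in> parts_in S n" if "\<pi> \<in> parts_in S n"
      "size (k (residue_rows a m \<pi>)) = size (residue_rows a m \<pi>)"
      "sum_mset (k (residue_rows a m \<pi>)) = sum_mset (residue_rows a m \<pi>)" for k \<pi>
  proof -
    have "sum_mset (H k \<pi>) = sum_mset \<pi>"
      using arg_cong[OF residue_rows_decompose[OF a(2), of \<pi>], of sum_mset] that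
      by (simp add: H_def sum_scale_mset)
    moreover have "x \<in> S \<and> 0 < x" if x: "x \<in># H k \<pi>" for x
      using \<open>\<pi> \<in> parts_in S n\<close> x S a
      by (auto simp: H_def scale_mset_def parts_in_def partitions_def cong_def)
    ultimately show ?thesis using that(1) by (auto simp: parts_in_def partitions_def)
  qed
  have "bij_betw (H h) {\<pi> \<in> parts_in S n. residue_rows a m \<pi> \<in> U}
      {\<pi> \<in> parts_in S n. residue_rows a m \<pi> \<in> V}"
  proof (rule bij_betw_byWitness[where f' = "H g"])
    show "\<forall>\<pi>\<in>{\<pi> \<in> parts_in S n. residue_rows a m \<pi> \<in> U}. H g (H h \<pi>) = \<pi>"
      by (auto simp: H_def[of g] rows gh residue_rows_decompose[OF a(2)])
    show "\<forall>\<pi>\<in>{\<pi> \<in> parts_in S n. residue_rows a m \<pi> \<in> V}. H h (H g \<pi>) = \<pi>"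
      by (auto simp: H_def[of h] rows hg residue_rows_decompose[OF a(2)])
    show "H h ` {\<pi> \<in> parts_in S n. residue_rows a m \<pi> \<in> U} \<subseteq>
        {\<pi> \<in> parts_in S n. residue_rows a m \<pi> \<in> V}"
      using same bij_betw_apply[OF h] by (auto simp: rows intro!: mem)
    have "size (g \<kappa>) = size \<kappa> \<and> sum_mset (g \<kappa>) = sum_mset \<kappa>" if "\<kappa> \<in> V" for \<kappa>
      using same[OF gU[OF that]] hg[OF that] by simp
    then show "H g ` {\<pi> \<in> parts_in S n. residue_rows a m \<pi> \<in> V} \<subseteq>
        {\<pi> \<in> parts_in S n. residue_rows a m \<pi> \<in> U}"
      using gU by (auto simp: rows intro!: mem)
  qed
  then show ?thesis by (rule bij_betw_same_card)
qed

section \<open>The recurrence in the index of the Durfee rectangle\<close>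

definition durfee_parts :: "nat set \<Rightarrow> nat \<Rightarrow> nat \<Rightarrow> nat \<Rightarrow> nat \<Rightarrow> nat multiset set" where
  "durfee_parts S a m \<nu> n = {\<pi> \<in> parts_in S n.
     {..\<nu>} \<subseteq> set_mset (residue_rows a m \<pi>) \<and> exact_durfee \<nu> (residue_rows a m \<pi>)}"

text \<open>Here the combinatorics meets the theta series: the forced parts add up to the exponent
  of index \<open>Suc \<nu>\<close>.\<close>

lemma sum_scale_mset_atMost:
  assumes "a \<le> m"
  shows "sum_mset (scale_mset a m (mset_set {..\<nu>})) = theta_exp a m (int (Suc \<nu>))"
proof (induction \<nu>)
  case 0
  then show ?case by (simp add: scale_mset_def theta_exp_def atMost_0)
next
  case (Suc \<nu>)
  have "int (theta_exp a m (int (Suc \<nu>) + 1)) =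
      int (theta_exp a m (int (Suc \<nu>))) + int a + int m * int (Suc \<nu>)"
    by (rule int_theta_exp_Suc[OF assms])
  also have "\<dots> = int (theta_exp a m (int (Suc \<nu>)) + a + m * Suc \<nu>)"
    by (simp only: of_nat_add of_nat_mult)
  finally have "theta_exp a m (int (Suc \<nu>) + 1) = theta_exp a m (int (Suc \<nu>)) + a + m * Suc \<nu>"
    by presburger
  moreover have "int (Suc \<nu>) + 1 = int (Suc (Suc \<nu>))" by simp
  moreover have "scale_mset a m (mset_set {..Suc \<nu>}) =
      add_mset (a + m * Suc \<nu>) (scale_mset a m (mset_set {..\<nu>}))"
    by (simp add: atMost_Suc scale_mset_def)
  ultimately show ?case using Suc by (simp only: sum_mset.insert) simp
qed

text \<open>Each forced part has multiplicity one in \<open>D\<close>, so its occurrence is the same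
  as inclusion of \<open>D\<close> as a submultiset, and \<open>D\<close> can be removed.\<close>

lemma card_parts_in_initial_rows:
  assumes a: "0 < a" "a < m" and S: "{x. [x = a] (mod m)} \<subseteq> S"
  shows "card {\<pi> \<in> parts_in S n. {..\<nu>} \<subseteq> set_mset (residue_rows a m \<pi>)} =
    (if theta_exp a m (int (Suc \<nu>)) \<le> n
     then card (parts_in S (n - theta_exp a m (int (Suc \<nu>)))) else 0)"
proof -
  define D where "D = scale_mset a m (mset_set {..\<nu>})"
  have "inj_on (\<lambda>k. a + m * k) {..\<nu>}" using a by (auto simp: inj_on_def)
  then have D: "D = mset_set ((\<lambda>k. a + m * k) ` {..\<nu>})"
    by (simp add: D_def scale_mset_def image_mset_mset_set)
  have "D \<subseteq># \<pi> \<longleftrightarrow> {..\<nu>} \<subseteq> set_mset (residue_rows a m \<pi>)" for \<pi>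
  proof -
    have "D \<subseteq># \<pi> \<longleftrightarrow> (\<lambda>k. a + m * k) ` {..\<nu>} \<subseteq> set_mset \<pi>"
      unfolding D by (auto simp: subseteq_mset_def count_mset_set' Suc_le_eq split: if_splits)
    then show ?thesis unfolding subset_residue_rows_iff[OF a(2)] by auto
  qed
  moreover have "set_mset D \<subseteq> S" "0 \<notin># D"
    using a S by (auto simp: D_def scale_mset_def cong_def)
  moreover have "sum_mset D = theta_exp a m (int (Suc \<nu>))"
    unfolding D_def using a by (intro sum_scale_mset_atMost) simp
  ultimately show ?thesis using card_parts_in_supermset[of D S n] by simp
qed

text \<open>Among the partitions containing the forced parts, those failing the Durfee condition for
  \<open>\<nu>\<close> correspond to those counted for \<open>Suc \<nu>\<close>.\<close>

lemma card_durfee_parts_add: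
  assumes a: "0 < a" "a < m" and S: "{x. [x = a] (mod m)} \<subseteq> S"
  shows "card (durfee_parts S a m \<nu> n) + card (durfee_parts S a m (Suc \<nu>) n) =
    (if theta_exp a m (int (Suc \<nu>)) \<le> n
     then card (parts_in S (n - theta_exp a m (int (Suc \<nu>)))) else 0)"
proof -
  let ?U = "{\<kappa>. {..\<nu>} \<subseteq> set_mset \<kappa> \<and> \<not> exact_durfee \<nu> \<kappa>}"
  let ?V = "{\<kappa>. {..Suc \<nu>} \<subseteq> set_mset \<kappa> \<and> exact_durfee (Suc \<nu>) \<kappa>}"
  obtain h where "bij_betw h ?U ?V"
    "\<And>\<kappa>. {..\<nu>} \<subseteq> set_mset \<kappa> \<Longrightarrow> \<not> exact_durfee \<nu> \<kappa> \<Longrightarrow>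
       size (h \<kappa>) = size \<kappa> \<and> sum_mset (h \<kappa>) = sum_mset \<kappa>"
    using exact_durfee_bijection[of \<nu>] by blast
  then have "card {\<pi> \<in> parts_in S n. residue_rows a m \<pi> \<in> ?U} =
      card {\<pi> \<in> parts_in S n. residue_rows a m \<pi> \<in> ?V}"
    by (intro card_parts_in_transfer[OF a S, of h]) auto
  also have "\<dots> = card (durfee_parts S a m (Suc \<nu>) n)"
    by (simp add: durfee_parts_def)
  finally have "card (durfee_parts S a m \<nu> n) + card (durfee_parts S a m (Suc \<nu>) n) =
      card (durfee_parts S a m \<nu> n \<union> {\<pi> \<in> parts_in S n. residue_rows a m \<pi> \<in> ?U})"
    by (subst card_Un_disjoint) (auto simp: durfee_parts_def finite_parts_in)
  also have "durfee_parts S a m \<nu> n \<union> {\<pi> \<in> parts_in S n. residue_rows a m \<pi> \<in> ?U} =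
      {\<pi> \<in> parts_in S n. {..\<nu>} \<subseteq> set_mset (residue_rows a m \<pi>)}"
    by (auto simp: durfee_parts_def)
  finally show ?thesis using card_parts_in_initial_rows[OF a S] by simp
qed

text \<open>The recurrence, solved for its first term and iterated \<open>K\<close> times; the
  remainder \<open>G K\<close> has no coefficient at \<open>n\<close>.\<close>

lemma card_durfee_parts_alternating:
  assumes a: "0 < a" "a < m" and S: "{x. [x = a] (mod m)} \<subseteq> S" and n: "n < m * K"
  shows "of_nat (card (durfee_parts S a m 0 n)) =
    fps_nth (parts_gf S * (\<Sum>i<K. (-1) ^ i * fps_X ^ theta_exp a m (int (Suc i)))) n"
proof -
  define G :: "nat \<Rightarrow> rat fps" where
    "G \<nu> = Abs_fps (\<lambda>n. of_nat (card (durfee_parts S a m \<nu> n)))" for \<nu>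
  have step: "G \<nu> = parts_gf S * fps_X ^ theta_exp a m (int (Suc \<nu>)) - G (Suc \<nu>)" for \<nu>
  proof (rule fps_ext)
    fix n
    have "fps_nth (G \<nu>) n + fps_nth (G (Suc \<nu>)) n =
        of_nat (card (durfee_parts S a m \<nu> n) + card (durfee_parts S a m (Suc \<nu>) n))"
      by (simp add: G_def)
    also have "\<dots> = fps_nth (parts_gf S * fps_X ^ theta_exp a m (int (Suc \<nu>))) n"
      unfolding card_durfee_parts_add[OF a S] by (simp add: parts_gf_def fps_X_power_mult_right_nth)
    finally show "fps_nth (G \<nu>) n =
        fps_nth (parts_gf S * fps_X ^ theta_exp a m (int (Suc \<nu>)) - G (Suc \<nu>)) n"
      by simp
  qed
  have "G 0 = parts_gf S *
      (\<Sum>i<K. (-1) ^ i * fps_X ^ theta_exp a m (int (Suc i))) + (-1) ^ K * G K" for K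
  proof (induction K)
    case (Suc K)
    then show ?case using step[of K] by (simp add: algebra_simps)
  qed simp
  moreover have "fps_nth ((-1) ^ K * G K) n = 0"
  proof -
    \<comment> \<open>The forced parts of index \<open>K\<close> already sum to at least
      \<open>m * K > n\<close>.\<close>
    have "m * nat \<bar>int (Suc K)\<bar> \<le> theta_exp a m (int (Suc K)) + m"
      using a by (intro theta_exp_ge) simp
    with n have "\<not> theta_exp a m (int (Suc K)) \<le> n" by (simp only: abs_of_nat nat_int) simp
    then have "card (durfee_parts S a m K n) = 0"
      using card_durfee_parts_add[OF a S, of K n] by simp
    then have "fps_nth (G K) n = 0" by (simp add: G_def)
    then show ?thesis by (cases "even K") auto
  qed
  ultimately have "fps_nth (G 0) n =
     fps_nth (parts_gf S * (\<Sum>i<K. (-1) ^ i * fps_X ^ theta_exp a m (int (Suc i)))) n"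
    by (metis add_0_right fps_add_nth)
  then show ?thesis by (simp add: G_def)
qed

text \<open>In the vanishing coefficient of \<open>parts_gf_theta\<close>, the constant 1 yields all
  partitions and the two alternating sums yield the two Durfee counts.\<close>

lemma card_parts_in_eq_durfee:
  assumes ab: "a + b = m" "0 < a" "0 < b" "a \<noteq> b" and n: "0 < n"
  defines "S \<equiv> {x. x mod m \<in> {0, a, b}}"
  shows "card (parts_in S n) = card (durfee_parts S a m 0 n) + card (durfee_parts S b m 0 n)"
proof -
  \<comment> \<open>This fixes the truncation as \<open>K = Suc n\<close>.\<close>
  have nK: "n < m * Suc n" using ab by (cases m) auto
  have "a < m" "b < m" using ab by auto
  then have "{x. [x = a] (mod m)} \<subseteq> S" "{x. [x = b] (mod m)} \<subseteq> S"
    by (auto simp: S_def cong_def)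
  with parts_gf_theta[OF ab n nK] card_durfee_parts_alternating[OF ab(2) \<open>a < m\<close> _ nK, of S]
    card_durfee_parts_alternating[OF ab(3) \<open>b < m\<close> _ nK, of S]
  have "rat_of_nat (card (parts_in S n)) =
      of_nat (card (durfee_parts S a m 0 n)) + of_nat (card (durfee_parts S b m 0 n))"
    unfolding S_def[symmetric] right_diff_distrib by (simp add: parts_gf_def)
  then show ?thesis by (metis of_nat_add of_nat_eq_iff)
qed

lemma M_partitions_durfee_parts:
  assumes a: "0 < a" "a < m"
  shows "{\<pi> \<in> parts_in S n.
      let \<beta> = sum_mset (filter_mset (\<lambda>x. \<not> [x = a] (mod m)) \<pi>) in
        filter_mset (\<lambda>x. [x = a] (mod m)) \<pi> \<in> M_partitions a m \<nu> (n - \<beta>)} =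
    durfee_parts S a m \<nu> n"
proof -
  have "filter_mset (\<lambda>x. [x = a] (mod m)) \<pi> \<in>
       M_partitions a m \<nu> (n - sum_mset (filter_mset (\<lambda>x. \<not> [x = a] (mod m)) \<pi>)) \<longleftrightarrow>
     {..\<nu>} \<subseteq> set_mset (residue_rows a m \<pi>) \<and> exact_durfee \<nu> (residue_rows a m \<pi>)"
    if "\<pi> \<in> parts_in S n" for \<pi>
  proof -
    let ?f = "filter_mset (\<lambda>x. [x = a] (mod m)) \<pi>"
    \<comment> \<open>Consequently the natural subtraction \<open>n - \<beta>\<close> in the
      definition is exact.\<close>
    have "sum_mset ?f + sum_mset (filter_mset (\<lambda>x. \<not> [x = a] (mod m)) \<pi>) = n"
      using that unfolding sum_mset.union[symmetric] multiset_partition[symmetric]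
      by (simp add: parts_in_def partitions_def)
    then have 1: "?f \<in> partitions (n - sum_mset (filter_mset (\<lambda>x. \<not> [x = a] (mod m)) \<pi>))"
      using that by (auto simp: parts_in_def partitions_def)
    have 2: "(\<forall>j\<le>\<nu>. a + m * j \<in># ?f) \<longleftrightarrow> {..\<nu>} \<subseteq> set_mset (residue_rows a m \<pi>)"
      unfolding subset_residue_rows_iff[OF a(2)] by (auto simp: cong_def)
    have 3: "(let t = durfee_height a m \<nu> ?f in
           \<forall>i. t < i \<and> i \<le> size ?f \<longrightarrow> row_length a m ?f i < t + \<nu> + 2) \<longleftrightarrow>
        exact_durfee \<nu> (residue_rows a m \<pi>)"
      unfolding scale_residue_rows[OF a(2), symmetric]
      using a by (intro durfee_condition_iff_exact_durfee) simp
    show ?thesis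
      unfolding M_partitions_def mem_Collect_eq 2 3 using 1 by simp
  qed
  then show ?thesis unfolding durfee_parts_def Let_def by blast
qed

theorem theorem1p9:
  fixes n :: nat
  assumes "n \<ge> 1"
  shows "p n = p_M 2 3 0 n + p_M 1 3 0 n \<and>
         p24 n = p24_M 3 0 n + p24_M 1 0 n"
proof
  \<comment> \<open>For \<open>m = 3\<close> the classes 0, 2 and 1 cover everything.\<close>
  have "x mod 3 = 0 \<or> x mod 3 = 2 \<or> x mod 3 = 1" for x :: nat by presburger
  then have "partitions n = parts_in {x. x mod 3 \<in> {0, 2, 1}} n"
    by (auto simp: parts_in_def)
  then show "p n = p_M 2 3 0 n + p_M 1 3 0 n"
    using card_parts_in_eq_durfee[of 2 1 3 n] assms
      M_partitions_durfee_parts[of 2 3 _ n 0] M_partitions_durfee_parts[of 1 3 _ n 0]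
    unfolding p_def p_M_def by simp
  \<comment> \<open>For \<open>m = 4\<close> the classes 0, 3 and 1 leave out exactly the forbidden
    one.\<close>
  have "\<not> [x = 2] (mod 4) \<longleftrightarrow> x mod 4 \<in> {0, 3, 1}" for x :: nat
    unfolding cong_def by simp presburger
  then have "partitions24 n = parts_in {x. x mod 4 \<in> {0, 3, 1}} n"
    by (auto simp: partitions24_def parts_in_def)
  then show "p24 n = p24_M 3 0 n + p24_M 1 0 n"
    using card_parts_in_eq_durfee[of 3 1 4 n] assms
      M_partitions_durfee_parts[of 3 4 _ n 0] M_partitions_durfee_parts[of 1 4 _ n 0]
    unfolding p24_def p24_M_def by simp
qed

end
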